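(* Let $p,q\ge 1$ and let $A,B,C_1,\dots,C_p,D_1,\dots,D_q$ be matrices in $\mathbb{C}^{r\times r}$ such that $C_p$, $D_q$, $D_q-C_p$ are positive stable and $C_pD_j=D_jC_p$ for all $1\le j\le q$. Then, for $|z|<1$, $${}_pR_q(A,B;z)=\left(\int_0^1 {}_{p-1}R_{q-1}\left(\begin{array}{c}C_1,\dots,C_{p-1}\\ D_1,\dots,D_{q-1}\end{array}\mid A,B;tz\right)t^{C_p-I}(1-t)^{D_q-C_p-I}\,dt\right)\Gamma(D_q)\,\Gamma^{-1}(C_p)\,\Gamma^{-1}(D_q-C_p).$$
   Context: A matrix is positive stable if all its eigenvalues have positive real part. For positive stable $M$, $\Gamma(M)=\int_0^\infty e^{-t}t^{M-I}\,dt$; $\Gamma^{-1}(M)$ denotes the entire function $1/\Gamma$ applied to $M$. For $t>0$, $t^M=\exp(M\ln t)$. The Pochhammer symbol of $M\in\mathbb{C}^{r\times r}$ is $(M)_0=I$, $(M)_n=M(M+I)\cdots(M+(n-1)I)$ for $n\ge 1$. For matrices $A,B,C_1,\dots,C_p,D_1,\dots,D_q\in\mathbb{C}^{r\times r}$ such that each $D_j+kI$ is invertible for all integers $k\ge 0$ (an assumption of the definition), one defines $${}_pR_q(A,B;z)={}_pR_q\left(\begin{array}{c}C_1,\dots,C_p\\ D_1,\dots,D_q\end{array}\mid A,B;z\right)=\sum_{n\ge 0}\Gamma^{-1}(nA+B)\,(C_1)_n\cdots(C_p)_n\,(D_1)_n^{-1}\cdots(D_q)_n^{-1}\,\frac{z^n}{n!},$$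 with products taken in the written order.
   Formalization: The series for pRq(A,B;z) can diverge under the stated hypotheses (e.g. r=p=q=1, A=-3, B=1/2, C_1=1, D_1=2), so it is additionally assumed that it converges at some w with |w|>|z|; this is automatic if it converges for all |z|<1. *)

theory Defs
  imports "HOL-Analysis.Analysis"
begin

text \<open>
  Matrices in $C^{r \times r}$ are rendered as \<^typ>\<open>complex^'r^'r\<close>. On this type \<open>*\<close> is the
  entrywise product, so matrix products are \<open>**\<close> and powers have to be introduced here. The
  scalar matrix $cI$ is \<open>mat c\<close>, and multiplication by a complex scalar \<open>c\<close> is \<open>mat c ** M\<close>.
\<close>

definition eigenvalue :: "complex^'r^'r \<Rightarrow> complex \<Rightarrow> bool" where
  "eigenvalue M l \<longleftrightarrow> (\<exists>v. v \<noteq> 0 \<and> M *v v = l *s v)"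

definition positive_stable :: "complex^'r^'r \<Rightarrow> bool" where
  "positive_stable M \<longleftrightarrow> (\<forall>l. eigenvalue M l \<longrightarrow> Re l > 0)"

primrec mat_pow :: "complex^'r^'r \<Rightarrow> nat \<Rightarrow> complex^'r^'r" where
  "mat_pow M 0 = mat 1"
| "mat_pow M (Suc n) = mat_pow M n ** M"

definition mat_exp :: "complex^'r^'r \<Rightarrow> complex^'r^'r" where
  "mat_exp M = (\<Sum>n. (1 / fact n) *\<^sub>R mat_pow M n)"

text \<open>$t^M$, meaningful for \<open>t > 0\<close> only.\<close>

definition mat_powr :: "real \<Rightarrow> complex^'r^'r \<Rightarrow> complex^'r^'r" where
  "mat_powr t M = mat_exp (ln t *\<^sub>R M)"

text \<open>The integral converges, and the value is meaningful, for positive stable \<open>M\<close> only.\<close>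

definition Gamma_mat :: "complex^'r^'r \<Rightarrow> complex^'r^'r" where
  "Gamma_mat M = integral {0<..} (\<lambda>t. exp (- t) *\<^sub>R mat_powr t (M - mat 1))"

text \<open>
  The entire function $1/\Gamma$ (\<^const>\<open>rGamma\<close>) applied to an arbitrary matrix: its everywhere
  convergent Taylor series at \<open>0\<close>, evaluated at the matrix.
\<close>

definition rGamma_mat :: "complex^'r^'r \<Rightarrow> complex^'r^'r" where
  "rGamma_mat M = (\<Sum>n. mat ((deriv ^^ n) rGamma 0 / fact n) ** mat_pow M n)"

primrec mat_pochhammer :: "complex^'r^'r \<Rightarrow> nat \<Rightarrow> complex^'r^'r" where
  "mat_pochhammer M 0 = mat 1"
| "mat_pochhammer M (Suc n) = mat_pochhammer M n ** (M + mat (of_nat n))"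

text \<open>The ordered product \<open>F 1 ** F 2 ** \<dots> ** F k\<close>.\<close>

primrec mat_prod :: "(nat \<Rightarrow> complex^'r^'r) \<Rightarrow> nat \<Rightarrow> complex^'r^'r" where
  "mat_prod F 0 = mat 1"
| "mat_prod F (Suc k) = mat_prod F k ** F (Suc k)"

text \<open>
  The parameter matrices are \<open>C 1, \<dots>, C p\<close> and \<open>D 1, \<dots>, D q\<close>; other values of \<open>C\<close> and \<open>D\<close> are
  never used. That all \<open>D j + mat (of_nat k)\<close> are invertible is an assumption wherever
  \<open>pRq\<close> is used, as \<^const>\<open>matrix_inv\<close> is unspecified at singular matrices.
\<close>

definition pRq_term ::
  "nat \<Rightarrow> nat \<Rightarrow> (nat \<Rightarrow> complex^'r^'r) \<Rightarrow> (nat \<Rightarrow> complex^'r^'r) \<Rightarrow>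
    complex^'r^'r \<Rightarrow> complex^'r^'r \<Rightarrow> complex \<Rightarrow> nat \<Rightarrow> complex^'r^'r" where
  "pRq_term p q C D A B z n =
    mat (z ^ n / fact n) ** (rGamma_mat (real n *\<^sub>R A + B)
      ** mat_prod (\<lambda>i. mat_pochhammer (C i) n) p
      ** mat_prod (\<lambda>j. matrix_inv (mat_pochhammer (D j) n)) q)"

definition pRq ::
  "nat \<Rightarrow> nat \<Rightarrow> (nat \<Rightarrow> complex^'r^'r) \<Rightarrow> (nat \<Rightarrow> complex^'r^'r) \<Rightarrow>
    complex^'r^'r \<Rightarrow> complex^'r^'r \<Rightarrow> complex \<Rightarrow> complex^'r^'r" where
  "pRq p q C D A B z = (\<Sum>n. pRq_term p q C D A B z n)"

end

theory Submission
  imports Defs "HOL-Complex_Analysis.Complex_Analysis" "HOL-Real_Asymp.Real_Asymp"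
    "HOL-Computational_Algebra.Fundamental_Theorem_Algebra"
begin

text \<open>
  Since \<open>C\<^sub>p\<close> commutes with all \<open>D\<^sub>j\<close>, the \<open>n\<close>-th term of the series on the left is the one of the
  reduced series times \<open>(C\<^sub>p)\<^sub>n (D\<^sub>q)\<^sub>n\<^sup>-\<^sup>1\<close>, and for commuting \<open>C\<close> and \<open>D\<close> the Beta integral gives
  \<open>(C)\<^sub>n (D)\<^sub>n\<^sup>-\<^sup>1 = \<integral>\<^sub>0\<^sup>1 t\<^sup>n t\<^sup>C\<^sup>-\<^sup>1 (1-t)\<^sup>D\<^sup>-\<^sup>C\<^sup>-\<^sup>1 dt \<cdot> \<Gamma>(D) \<Gamma>\<^sup>-\<^sup>1(C) \<Gamma>\<^sup>-\<^sup>1(D-C)\<close>;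
  sum and integral are exchanged by dominated convergence.

  The properties of the Gamma and Beta integrals hold in any Banach algebra once positive
  stability is replaced by its consequence \<open>\<parallel>t\<^sup>M\<parallel> \<le> K t\<^sup>a\<close> on \<open>(0, 1]\<close> with \<open>a > 0\<close>. That \<open>\<Gamma>(M)\<close> and the
  Taylor series of \<open>1/\<Gamma>\<close> at \<open>M\<close> are inverse to each other follows from the scalar case by
  multiplying the power series of \<open>\<Gamma>\<close> and \<open>1/\<Gamma>\<close> around some \<open>n > \<parallel>M\<parallel>\<close>, both evaluated at \<open>M\<close>, and by
  descending from \<open>M + n\<close> to \<open>M\<close> with the functional equation.
\<close>

section \<open>The Gamma Integral in a Banach Algebra\<close>

definition tpow :: "real \<Rightarrow> 'a::{real_normed_algebra_1,banach} \<Rightarrow> 'a" where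
  "tpow t M = exp (ln t *\<^sub>R M)"

definition exp_stable :: "'a::{real_normed_algebra_1,banach} \<Rightarrow> bool" where
  "exp_stable M \<longleftrightarrow> (\<exists>K a. a > 0 \<and> (\<forall>t\<in>{0<..1}. norm (tpow t M) \<le> K * t powr a))"

lemma exp_commute:
  fixes X M :: "'a::{real_normed_algebra_1,banach}"
  assumes "X * M = M * X"
  shows "X * exp M = exp M * X"
proof -
  have p: "X * M ^ n = M ^ n * X" for n
    by (rule power_commuting_commutes [OF assms [symmetric], symmetric])
  have "X * exp M = (\<Sum>n. X * (M ^ n /\<^sub>R fact n))"
    unfolding exp_def by (rule suminf_mult [symmetric, OF summable_exp_generic])
  also have "\<dots> = (\<Sum>n. (M ^ n /\<^sub>R fact n) * X)"
    by (simp add: p)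
  also have "\<dots> = exp M * X"
    unfolding exp_def by (rule suminf_mult2 [symmetric, OF summable_exp_generic])
  finally show ?thesis .
qed

lemma tpow_commute:
  "X * M = M * X \<Longrightarrow> X * tpow t M = tpow t M * X"
  unfolding tpow_def by (rule exp_commute) simp

lemma tpow_add:
  "M * N = N * M \<Longrightarrow> tpow t (M + N) = tpow t M * tpow t N"
  unfolding tpow_def scaleR_add_right by (rule exp_add_commuting) simp

lemma tpow_mult:
  "s > 0 \<Longrightarrow> t > 0 \<Longrightarrow> tpow (s * t) M = tpow s M * tpow t M"
  unfolding tpow_def by (simp add: ln_mult scaleR_add_left exp_add_commuting)

lemma tpow_of_real: "t > 0 \<Longrightarrow> tpow t (of_real x) = of_real (t powr x)"
  unfolding tpow_def powr_def
  by (simp add: scaleR_conv_of_real mult.commute flip: exp_of_real of_real_mult)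

lemma tpow_add_of_real:
  assumes "t > 0"
  shows "tpow t (M + of_real x) = t powr x *\<^sub>R tpow t M"
proof -
  have "tpow t (M + of_real x) = tpow t M * of_real (t powr x)"
    using assms by (subst tpow_add) (simp_all add: tpow_of_real del: of_real_def, simp add: of_real_def)
  then show ?thesis by (simp add: of_real_def)
qed

lemma tpow_add_of_nat: "t > 0 \<Longrightarrow> tpow t (M + of_nat n) = t ^ n *\<^sub>R tpow t M"
  using tpow_add_of_real [of t M "real n"] by (simp add: powr_realpow)

lemma tpow_diff_1: "t > 0 \<Longrightarrow> tpow t (M - 1) = (1 / t) *\<^sub>R tpow t M"
  using tpow_add_of_real [of t M "-1"] by (simp add: powr_minus_divide)

lemma measurable_tpow [measurable]:
  fixes M :: "'a::{real_normed_algebra_1,banach,second_countable_topology}"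
  shows "(\<lambda>t. tpow t M) \<in> borel_measurable borel"
proof -
  have "continuous_on UNIV (\<lambda>x. exp (x *\<^sub>R M))"
    by (intro continuous_at_imp_continuous_on ballI)
      (rule has_vector_derivative_continuous [OF exp_scaleR_has_vector_derivative_right])
  then have "(\<lambda>x. exp (x *\<^sub>R M)) \<in> borel_measurable borel"
    by (rule borel_measurable_continuous_onI)
  from measurable_compose [OF borel_measurable_ln this, of "\<lambda>t. t"] show ?thesis
    by (simp add: tpow_def)
qed

lemma norm_tpow_le_powr:
  assumes "t \<ge> 1"
  shows "norm (tpow t M) \<le> t powr norm M"
proof -
  have "norm (tpow t M) \<le> exp (norm (ln t *\<^sub>R M))"
    unfolding tpow_def by (rule norm_exp)
  also have "\<dots> = t powr norm M"
    using assms by (simp add: powr_def mult.commute)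
  finally show ?thesis .
qed

lemma exp_stableE:
  assumes "exp_stable M"
  obtains K a where "a > 0" "K \<ge> 0" "\<And>t. 0 < t \<Longrightarrow> t \<le> 1 \<Longrightarrow> norm (tpow t M) \<le> K * t powr a"
proof -
  from assms obtain K a where *: "a > 0" "\<And>t. 0 < t \<Longrightarrow> t \<le> 1 \<Longrightarrow> norm (tpow t M) \<le> K * t powr a"
    unfolding exp_stable_def by (metis greaterThanAtMost_iff)
  moreover have "K \<ge> 0"
    using *(2)[of 1] by (simp add: tpow_def)
  ultimately show thesis using that by blast
qed

lemma exp_stableE':
  assumes "exp_stable M"
  obtains K a where "a > 0" "K \<ge> 0"
    "\<And>t. 0 < t \<Longrightarrow> t < 1 \<Longrightarrow> norm (tpow t (M - 1)) \<le> K * t powr (a - 1)"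
    "\<And>t. 0 < t \<Longrightarrow> norm (tpow t (M - 1)) \<le> K * t powr (a - 1) + t powr norm M"
proof -
  obtain K a where a: "a > 0" "K \<ge> 0"
    "\<And>t. 0 < t \<Longrightarrow> t \<le> 1 \<Longrightarrow> norm (tpow t M) \<le> K * t powr a"
    using assms by (rule exp_stableE) blast
  have 1: "norm (tpow t (M - 1)) \<le> K * t powr (a - 1)" if "0 < t" "t \<le> 1" for t
    using a(3)[OF that] that by (simp add: tpow_diff_1 divide_right_mono powr_diff field_simps)
  have 2: "norm (tpow t (M - 1)) \<le> K * t powr (a - 1) + t powr norm M" if "0 < t" for t
  proof (cases "t \<le> 1")
    case True
    then show ?thesis using 1[OF that True] by (smt (verit) powr_ge_zero)
  next
    case False
    then have "norm (tpow t (M - 1)) \<le> norm (tpow t M)"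
      by (simp add: tpow_diff_1 divide_le_eq mult_le_cancel_left1)
    also have "\<dots> \<le> t powr norm M" using False by (intro norm_tpow_le_powr) auto
    finally show ?thesis using a(2) by (smt (verit) powr_ge_zero mult_nonneg_nonneg)
  qed
  show thesis using that[OF a(1,2) _ 2] 1 by auto
qed

lemma exp_stable_add_of_nat:
  assumes "exp_stable M"
  shows "exp_stable (M + of_nat n)"
proof -
  obtain K a where a: "a > 0" "K \<ge> 0"
    "\<And>t. 0 < t \<Longrightarrow> t \<le> 1 \<Longrightarrow> norm (tpow t M) \<le> K * t powr a"
    using assms by (rule exp_stableE) blast
  have "norm (tpow t (M + of_nat n)) \<le> K * t powr a" if "t \<in> {0<..1}" for t
  proof -
    have "norm (tpow t (M + of_nat n)) \<le> 1 * norm (tpow t M)"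
      using that by (simp add: tpow_add_of_nat power_le_one mult_left_le_one_le)
    then show ?thesis using a(3)[of t] that by auto
  qed
  then show ?thesis using a(1) unfolding exp_stable_def by blast
qed

definition Gamma_integrand :: "'a::{real_normed_algebra_1,banach} \<Rightarrow> real \<Rightarrow> 'a" where
  "Gamma_integrand M t = exp (- t) *\<^sub>R tpow t (M - 1)"

definition Gamma_alg :: "'a::{real_normed_algebra_1,banach,second_countable_topology} \<Rightarrow> 'a" where
  "Gamma_alg M = (LINT t:{0<..}|lborel. Gamma_integrand M t)"

lemma measurable_Gamma_integrand [measurable]:
  fixes M :: "'a::{real_normed_algebra_1,banach,second_countable_topology}"
  shows "Gamma_integrand M \<in> borel_measurable borel"
  unfolding Gamma_integrand_def by measurable

lemma set_integrable_Gamma_powr: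
  assumes "x > (0::real)"
  shows "set_integrable lborel {0<..} (\<lambda>t. exp (- t) * t powr (x - 1))"
proof -
  have "((\<lambda>t. t powr (x - 1) / exp t) has_integral Gamma x) {0..}"
    using assms by (rule Gamma_integral_real)
  then have "(\<lambda>t. t powr (x - 1) / exp t) absolutely_integrable_on {0..}"
    by (intro nonnegative_absolutely_integrable_1) auto
  then have "(\<lambda>t. t powr (x - 1) / exp t) absolutely_integrable_on {0<..}"
    by (rule set_integrable_subset) auto
  then have "set_integrable lborel {0<..} (\<lambda>t. t powr (x - 1) / exp t)"
    unfolding set_integrable_def by (subst (asm) integrable_completion) measurable
  then show ?thesis by (simp add: exp_minus field_simps)
qed

lemma set_integrable_Gamma_integrand:
  fixes M :: "'a::{real_normed_algebra_1,banach,second_countable_topology}"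
  assumes "exp_stable M"
  shows "set_integrable lborel {0<..} (Gamma_integrand M)"
proof -
  obtain K a where a: "a > 0" "K \<ge> 0"
    "\<And>t. 0 < t \<Longrightarrow> norm (tpow t (M - 1)) \<le> K * t powr (a - 1) + t powr norm M"
    using assms by (rule exp_stableE') blast
  have "set_integrable lborel {0<..}
      (\<lambda>t. K * (exp (- t) * t powr (a - 1)) + exp (- t) * t powr (norm M + 1 - 1))"
    using a(1) by (intro set_integral_add set_integrable_mult_right set_integrable_Gamma_powr)
      (auto simp: add_nonneg_pos)
  then show ?thesis
  proof (rule set_integrable_bound)
    show "set_borel_measurable lborel {0<..} (Gamma_integrand M)"
      unfolding set_borel_measurable_def by measurable
    show "AE t in lborel. t \<in> {0<..} \<longrightarrow> norm (Gamma_integrand M t)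
       \<le> norm (K * (exp (- t) * t powr (a - 1)) + exp (- t) * t powr (norm M + 1 - 1))"
    proof (intro AE_I2 impI)
      fix t :: real assume "t \<in> {0<..}"
      then have "norm (Gamma_integrand M t) \<le> exp (- t) * (K * t powr (a - 1) + t powr norm M)"
        using a(3)[of t] by (auto simp: Gamma_integrand_def)
      also have "\<dots> = K * (exp (- t) * t powr (a - 1)) + exp (- t) * t powr (norm M + 1 - 1)"
        by (simp add: algebra_simps)
      finally show "norm (Gamma_integrand M t)
       \<le> norm (K * (exp (- t) * t powr (a - 1)) + exp (- t) * t powr (norm M + 1 - 1))"
        by simp
    qed
  qed
qed

lemma
  fixes c :: "'a::{real_normed_algebra,banach,second_countable_topology}"
  assumes "set_integrable M A f"
  shows set_integrable_mult_right_alg: "set_integrable M A (\<lambda>t. c * f t)"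
    and set_integral_mult_right_alg: "(LINT t:A|M. c * f t) = c * (LINT t:A|M. f t)"
    and set_integral_mult_left_alg: "(LINT t:A|M. f t * c) = (LINT t:A|M. f t) * c"
proof -
  have int: "integrable M (\<lambda>t. indicator A t *\<^sub>R f t)"
    using assms by (simp add: set_integrable_def)
  have r: "indicator A t *\<^sub>R (c * f t) = c * (indicator A t *\<^sub>R f t)"
    and l: "indicator A t *\<^sub>R (f t * c) = (indicator A t *\<^sub>R f t) * c" for t
    by simp_all
  show "set_integrable M A (\<lambda>t. c * f t)"
    unfolding set_integrable_def r using int by (intro integrable_mult_right) simp
  show "(LINT t:A|M. c * f t) = c * (LINT t:A|M. f t)"
    unfolding set_lebesgue_integral_def r by (rule Bochner_Integration.integral_mult_right) (rule int)
  show "(LINT t:A|M. f t * c) = (LINT t:A|M. f t) * c"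
    unfolding set_lebesgue_integral_def l by (rule Bochner_Integration.integral_mult_left) (rule int)
qed

lemma Gamma_alg_commute:
  fixes M X :: "'a::{real_normed_algebra_1,banach,second_countable_topology}"
  assumes "exp_stable M" "X * M = M * X"
  shows "X * Gamma_alg M = Gamma_alg M * X"
proof -
  have "X * (M - 1) = (M - 1) * X" using assms(2) by (simp add: algebra_simps)
  then have *: "X * tpow t (M - 1) = tpow t (M - 1) * X" for t
    by (rule tpow_commute)
  have "X * Gamma_integrand M t = Gamma_integrand M t * X" for t
    by (simp add: Gamma_integrand_def *)
  then show ?thesis
    using set_integrable_Gamma_integrand [OF assms(1)]
    by (simp add: Gamma_alg_def flip: set_integral_mult_right_alg set_integral_mult_left_alg)
qed

primrec pochhammer_alg :: "'a::real_normed_algebra_1 \<Rightarrow> nat \<Rightarrow> 'a" where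
  "pochhammer_alg M 0 = 1"
| "pochhammer_alg M (Suc n) = pochhammer_alg M n * (M + of_nat n)"

lemma pochhammer_alg_commute:
  assumes "X * M = M * X"
  shows "X * pochhammer_alg M n = pochhammer_alg M n * X"
proof (induction n)
  case (Suc n)
  have "X * (M + of_nat n) = (M + of_nat n) * X"
    by (simp add: algebra_simps assms mult_of_nat_commute)
  with Suc show ?case by (metis mult.assoc pochhammer_alg.simps(2))
qed simp

lemma tpow_scaled_difference_tendsto:
  fixes M :: "'a::{real_normed_algebra_1,banach}"
  shows "(\<lambda>k. real (Suc k) *\<^sub>R (1 - tpow (1 / (1 + 1 / real (Suc k))) M)) \<longlonglongrightarrow> M"
proof -
  let ?f = "\<lambda>h::real. exp ((- ln (1 + h)) *\<^sub>R M)"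
  have "((\<lambda>h. - ln (1 + h)) has_vector_derivative -1) (at (0::real))"
    by (auto intro!: derivative_eq_intros simp flip: has_real_derivative_iff_has_vector_derivative)
  from vector_diff_chain_at [OF this exp_scaleR_has_vector_derivative_right [of M]]
  have "(?f has_vector_derivative (-1) *\<^sub>R M) (at 0)"
    by (simp add: o_def)
  then have "((\<lambda>h. norm (?f h - 1 - h *\<^sub>R (- M)) / norm h) \<longlongrightarrow> 0) (at 0)"
    unfolding has_vector_derivative_def has_derivative_at by (auto simp del: scaleR_minus_left)
  then have "((\<lambda>h. norm ((?f h - 1) /\<^sub>R h - - M)) \<longlongrightarrow> 0) (at 0)"
  proof (rule filterlim_mono_eventually)
    have "norm (?f h - 1 - h *\<^sub>R (- M)) / norm h = norm ((?f h - 1) /\<^sub>R h - - M)" if "h \<noteq> 0" for h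
    proof -
      have "(?f h - 1) /\<^sub>R h - - M = (?f h - 1 - h *\<^sub>R (- M)) /\<^sub>R h"
        using that by (simp add: algebra_simps)
      then show ?thesis by (simp add: divide_inverse mult.commute)
    qed
    then show "\<forall>\<^sub>F h in at 0. norm (?f h - 1 - h *\<^sub>R (- M)) / norm h = norm ((?f h - 1) /\<^sub>R h - - M)"
      by (auto simp: eventually_at_filter)
  qed simp_all
  then have "((\<lambda>h. (?f h - 1) /\<^sub>R h) \<longlongrightarrow> - M) (at 0)"
    by (simp add: LIM_zero_iff tendsto_norm_zero_iff del: diff_minus_eq_add)
  then have "(\<lambda>k. (?f (1 / real (Suc k)) - 1) /\<^sub>R (1 / real (Suc k))) \<longlonglongrightarrow> - M"
    by (rule filterlim_compose) real_asymp
  from tendsto_minus [OF this] show ?thesis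
    by (simp add: tpow_def ln_divide_pos add_pos_nonneg algebra_simps)
qed

lemma set_integral_scale:
  fixes f :: "real \<Rightarrow> 'a::{banach,second_countable_topology}"
  assumes "c > 0"
  shows "(LINT t:{0<..}|lborel. f t) = c *\<^sub>R (LINT t:{0<..}|lborel. f (c * t))"
  unfolding set_lebesgue_integral_def
  by (subst lborel_integral_real_affine [where c = c and t = 0])
    (use assms in \<open>auto simp: indicator_def zero_less_mult_iff\<close>)

lemma tpow_inverse_cancel: "t > 0 \<Longrightarrow> tpow (1 / t) M * tpow t M = 1"
  using tpow_mult [of "1/t" t M] by (simp add: tpow_def)

lemma set_integrable_Gamma_integrand_scaled:
  fixes M :: "'a::{real_normed_algebra_1,banach,second_countable_topology}"
  assumes "exp_stable M" and "c > 0"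
  shows "set_integrable lborel {0<..} (\<lambda>t. exp (- (c * t)) *\<^sub>R tpow t (M - 1))" (is ?int)
    and "(LINT t:{0<..}|lborel. exp (- (c * t)) *\<^sub>R tpow t (M - 1)) = tpow (1 / c) M * Gamma_alg M"
proof -
  have int: "integrable lborel (\<lambda>t. indicator {0<..} t *\<^sub>R Gamma_integrand M t)"
    using set_integrable_Gamma_integrand [OF assms(1)] by (simp add: set_integrable_def)
  have "integrable lborel (\<lambda>t. indicator {0<..} (0 + c * t) *\<^sub>R Gamma_integrand M (0 + c * t))"
    by (rule lborel_integrable_real_affine [OF int]) (use assms in simp)
  then have int0: "set_integrable lborel {0<..} (\<lambda>t. Gamma_integrand M (c * t))"
    unfolding set_integrable_def
    by (rule Bochner_Integration.integrable_cong [THEN iffD1, rotated -1])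
      (use assms in \<open>auto simp: indicator_def zero_less_mult_iff\<close>)
  have int': "set_integrable lborel {0<..} (\<lambda>t. (c *\<^sub>R tpow (1 / c) M) * Gamma_integrand M (c * t))"
    using int0 by (rule set_integrable_mult_right_alg)
  have eq: "(c *\<^sub>R tpow (1 / c) M) * Gamma_integrand M (c * t) = exp (- (c * t)) *\<^sub>R tpow t (M - 1)"
    if "t > 0" for t
  proof -
    have "tpow (1 / c) M * tpow (c * t) M = tpow t M"
      using that assms by (simp add: tpow_mult tpow_inverse_cancel flip: mult.assoc)
    then show ?thesis
      using that assms by (simp add: Gamma_integrand_def tpow_diff_1)
  qed
  show ?int
    using int' by (rule set_integrable_cong [THEN iffD1, rotated -1]) (use eq in auto)
  have "(LINT t:{0<..}|lborel. exp (- (c * t)) *\<^sub>R tpow t (M - 1)) =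
      (LINT t:{0<..}|lborel. (c *\<^sub>R tpow (1 / c) M) * Gamma_integrand M (c * t))"
    by (intro set_lebesgue_integral_cong) (use eq in auto)
  also have "\<dots> = (c *\<^sub>R tpow (1 / c) M) * (LINT t:{0<..}|lborel. Gamma_integrand M (c * t))"
    by (rule set_integral_mult_right_alg [OF int0])
  also have "\<dots> = tpow (1 / c) M * Gamma_alg M"
    unfolding Gamma_alg_def using assms by (subst set_integral_scale [of c]) simp_all
  finally show "(LINT t:{0<..}|lborel. exp (- (c * t)) *\<^sub>R tpow t (M - 1)) = tpow (1 / c) M * Gamma_alg M" .
qed

text \<open>
  The derivative at \<open>c = 1\<close> of \<open>c\<^sup>-\<^sup>M \<Gamma>(M) = \<integral> e\<^sup>-\<^sup>c\<^sup>t t\<^sup>M\<^sup>-\<^sup>1 dt\<close>. The library's fundamental theorem of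
  calculus for the Bochner integral, needed for integration by parts, is restricted to Euclidean spaces.
\<close>

lemma Gamma_alg_add_1:
  fixes M :: "'a::{real_normed_algebra_1,banach,second_countable_topology}"
  assumes M: "exp_stable M"
  shows "Gamma_alg (M + 1) = M * Gamma_alg M"
proof -
  define c where "c k = 1 + 1 / real (Suc k)" for k
  have c: "c k > 0" for k by (simp add: c_def add_pos_nonneg)
  let ?I = "\<lambda>t. indicator {0<..} t :: real"
  let ?s = "\<lambda>k t. ?I t *\<^sub>R (real (Suc k) *\<^sub>R (Gamma_integrand M t - exp (- (c k * t)) *\<^sub>R tpow t (M - 1)))"
  have stable: "exp_stable (M + 1)" using exp_stable_add_of_nat [OF M, of 1] by simp
  have s_eq: "?s k t = ?I t *\<^sub>R ((real (Suc k) * (1 - exp (- (t / real (Suc k))))) *\<^sub>R Gamma_integrand M t)" for k t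
  proof -
    have "exp (- (c k * t)) = exp (- t) * exp (- (t / real (Suc k)))"
      by (simp add: c_def algebra_simps flip: exp_add)
    then show ?thesis by (simp add: Gamma_integrand_def algebra_simps)
  qed
  have Suc_eq: "Gamma_integrand (M + 1) t = t *\<^sub>R Gamma_integrand M t" if "t > 0" for t
    using that tpow_add_of_nat [of t "M - 1" 1] by (simp add: Gamma_integrand_def)
  have "(\<lambda>k. LINT t|lborel. ?s k t) \<longlonglongrightarrow> (LINT t|lborel. ?I t *\<^sub>R Gamma_integrand (M + 1) t)"
  proof (rule integral_dominated_convergence [where w = "\<lambda>t. norm (?I t *\<^sub>R Gamma_integrand (M + 1) t)"])
    show "integrable lborel (\<lambda>t. norm (?I t *\<^sub>R Gamma_integrand (M + 1) t))"
      using set_integrable_Gamma_integrand [OF stable] unfolding set_integrable_def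
      by (rule integrable_norm)
    show "AE t in lborel. (\<lambda>k. ?s k t) \<longlonglongrightarrow> ?I t *\<^sub>R Gamma_integrand (M + 1) t"
    proof (rule AE_I2)
      fix t :: real
      have "(\<lambda>k. real k * (1 - exp (- (t / real k)))) \<longlonglongrightarrow> t"
        by real_asymp
      then have "(\<lambda>k. real (Suc k) * (1 - exp (- (t / real (Suc k))))) \<longlonglongrightarrow> t"
        by (rule LIMSEQ_Suc)
      then have "(\<lambda>k. ?s k t) \<longlonglongrightarrow> ?I t *\<^sub>R (t *\<^sub>R Gamma_integrand M t)"
        unfolding s_eq by (intro tendsto_scaleR tendsto_const)
      then show "(\<lambda>k. ?s k t) \<longlonglongrightarrow> ?I t *\<^sub>R Gamma_integrand (M + 1) t"
        by (cases "t > 0") (simp_all add: Suc_eq)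
    qed
    show "AE t in lborel. norm (?s k t) \<le> norm (?I t *\<^sub>R Gamma_integrand (M + 1) t)" for k
    proof (rule AE_I2)
      fix t :: real
      show "norm (?s k t) \<le> norm (?I t *\<^sub>R Gamma_integrand (M + 1) t)"
      proof (cases "t > 0")
        case True
        have "1 - t / real (Suc k) \<le> exp (- (t / real (Suc k)))"
          using exp_ge_add_one_self [of "- (t / real (Suc k))"] by simp
        then have "real (Suc k) * (1 - exp (- (t / real (Suc k)))) \<le> t"
          by (simp add: field_simps)
        moreover have "0 \<le> real (Suc k) * (1 - exp (- (t / real (Suc k))))"
          using True by (intro mult_nonneg_nonneg) simp_all
        ultimately have "\<bar>real (Suc k) * (1 - exp (- (t / real (Suc k))))\<bar> \<le> t" by simp
        then show ?thesis
          unfolding s_eq using True by (simp only: Suc_eq norm_scaleR) (intro mult_left_mono mult_right_mono, auto)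
      qed simp
    qed
  qed measurable
  moreover have "(LINT t|lborel. ?s k t) = (real (Suc k) *\<^sub>R (1 - tpow (1 / c k) M)) * Gamma_alg M" for k
  proof -
    note int1 = set_integrable_Gamma_integrand [OF M]
    note int2 = set_integrable_Gamma_integrand_scaled(1) [OF M c [of k]]
    note int2' = set_integrable_Gamma_integrand_scaled(2) [OF M c [of k]]
    have "(LINT t|lborel. ?s k t) = real (Suc k) *\<^sub>R
        (LINT t:{0<..}|lborel. Gamma_integrand M t - exp (- (c k * t)) *\<^sub>R tpow t (M - 1))"
      unfolding scaleR_left_commute [of "?I _"] set_lebesgue_integral_def
      by (rule integral_scaleR_right)
    also have "\<dots> = real (Suc k) *\<^sub>R (Gamma_alg M - tpow (1 / c k) M * Gamma_alg M)"
      using set_integral_diff(2) [OF int1 int2] int2'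
      by (simp add: Gamma_alg_def)
    finally show ?thesis by (simp add: algebra_simps)
  qed
  ultimately have "(\<lambda>k. (real (Suc k) *\<^sub>R (1 - tpow (1 / c k) M)) * Gamma_alg M) \<longlonglongrightarrow> Gamma_alg (M + 1)"
    by (simp add: Gamma_alg_def set_lebesgue_integral_def)
  moreover have "(\<lambda>k. (real (Suc k) *\<^sub>R (1 - tpow (1 / c k) M)) * Gamma_alg M) \<longlonglongrightarrow> M * Gamma_alg M"
    unfolding c_def by (intro tendsto_mult tpow_scaled_difference_tendsto tendsto_const)
  ultimately show ?thesis by (rule LIMSEQ_unique)
qed

lemma Gamma_alg_add_of_nat:
  fixes M :: "'a::{real_normed_algebra_1,banach,second_countable_topology}"
  assumes M: "exp_stable M"
  shows "Gamma_alg (M + of_nat n) = pochhammer_alg M n * Gamma_alg M"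
proof (induction n)
  case (Suc n)
  have "Gamma_alg (M + of_nat (Suc n)) = (M + of_nat n) * Gamma_alg (M + of_nat n)"
    using Gamma_alg_add_1 [OF exp_stable_add_of_nat [OF M, of n]] by (simp add: add_ac)
  also have "\<dots> = pochhammer_alg M n * (M + of_nat n) * Gamma_alg M"
    unfolding Suc mult.assoc [symmetric]
    by (subst pochhammer_alg_commute) (simp_all add: algebra_simps mult_of_nat_commute)
  finally show ?case by simp
qed simp

lemma real_powser_unique:
  fixes a b :: "nat \<Rightarrow> real"
  assumes "r > 0"
    and a: "\<And>s. \<bar>s\<bar> < r \<Longrightarrow> (\<lambda>j. a j * s ^ j) sums f s"
    and b: "\<And>s. \<bar>s\<bar> < r \<Longrightarrow> (\<lambda>j. b j * s ^ j) sums f s"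
  shows "a j = b j"
proof (rule ccontr)
  assume neq: "a j \<noteq> b j"
  have sums: "(\<lambda>j. (a j - b j) * (s - 0) ^ j) sums 0" if "norm (s - 0) < r" for s
    using sums_diff [OF a [of s] b [of s]] that by (simp add: left_diff_distrib)
  have "(\<lambda>j. (a j - b j) * 0 ^ j) sums (a 0 - b 0)" by simp
  then have "a 0 - b 0 = 0"
    using sums [of 0] \<open>r > 0\<close> sums_unique2 by fastforce
  with neq have "j > 0" by (cases j) auto
  then obtain s where "0 < s" "\<And>z. z \<in> cball 0 s - {0::real} \<Longrightarrow> (\<lambda>_. 0::real) z \<noteq> 0"
    using powser_0_nonzero [of r 0 "\<lambda>j. a j - b j" "\<lambda>_. 0" j] sums neq \<open>r > 0\<close> by auto
  from this(2) [of s] \<open>0 < s\<close> show False by simp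
qed

lemma powser_scaleR_mult_linear:
  fixes M :: "'a::{real_normed_algebra_1,banach}"
  assumes "(\<lambda>j. g j *\<^sub>R M ^ j) sums G"
  shows "(\<lambda>j. ((case j of 0 \<Rightarrow> 0 | Suc i \<Rightarrow> g i) + x * g j) *\<^sub>R M ^ j) sums (G * (M + of_real x))"
proof -
  have "(\<lambda>j. (g j *\<^sub>R M ^ j) * M) sums (G * M)"
    by (rule sums_mult2 [OF assms])
  then have "(\<lambda>j. (case Suc j of 0 \<Rightarrow> 0 | Suc i \<Rightarrow> g i) *\<^sub>R M ^ Suc j) sums (G * M)"
    by (simp add: power_commutes)
  then have 1: "(\<lambda>j. (case j of 0 \<Rightarrow> 0 | Suc i \<Rightarrow> g i) *\<^sub>R M ^ j) sums (G * M)"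
    by (subst (asm) sums_Suc_iff) simp
  have 2: "(\<lambda>j. (x * g j) *\<^sub>R M ^ j) sums (x *\<^sub>R G)"
    using sums_scaleR_right [OF assms, of x] by simp
  show ?thesis
    using sums_add [OF 1 2] by (simp add: scaleR_add_left algebra_simps of_real_def)
qed

section \<open>The Reciprocal Gamma Function\<close>

definition rGamma_coeff :: "nat \<Rightarrow> nat \<Rightarrow> real" where
  "rGamma_coeff n j = Re ((deriv ^^ j) rGamma (of_nat n) / fact j)"

text \<open>The entire function \<open>s \<mapsto> 1/\<Gamma>(n + s)\<close> at \<open>M\<close>.\<close>

definition rGamma_shift :: "nat \<Rightarrow> 'a::{real_normed_algebra_1,banach} \<Rightarrow> 'a" where
  "rGamma_shift n M = (\<Sum>j. rGamma_coeff n j *\<^sub>R M ^ j)"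

lemma rGamma_complex_sums:
  "(\<lambda>j. (deriv ^^ j) rGamma (of_nat n) / fact j * of_real s ^ j) sums complex_of_real (rGamma (of_nat n + s))"
proof -
  have "(\<lambda>j. (deriv ^^ j) rGamma (of_nat n) / fact j * (of_real (of_nat n + s) - of_nat n) ^ j) sums
      rGamma (complex_of_real (of_nat n + s))"
    by (rule holomorphic_power_series [where r = "\<bar>s\<bar> + 1"]) (simp_all add: holomorphic_rGamma dist_norm norm_minus_commute)
  then show ?thesis unfolding rGamma_complex_of_real by simp
qed

lemma
  shows Re_mult_of_real: "Re (z * complex_of_real x) = Re z * x"
    and Im_mult_of_real: "Im (z * complex_of_real x) = Im z * x"
  by simp_all

lemma rGamma_coeff_sums: "(\<lambda>j. rGamma_coeff n j * s ^ j) sums rGamma (of_nat n + s)"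
  using sums_Re [OF rGamma_complex_sums [of n s]]
  by (simp only: of_real_power [symmetric] Re_mult_of_real rGamma_coeff_def Re_complex_of_real)

lemma of_real_rGamma_coeff:
  "complex_of_real (rGamma_coeff n j) = (deriv ^^ j) rGamma (of_nat n) / fact j"
proof -
  have "Im ((deriv ^^ j) rGamma (of_nat n) / fact j) = 0" for j
  proof (rule real_powser_unique [where r = 1 and f = "\<lambda>_. 0"])
    show "(\<lambda>j. Im ((deriv ^^ j) rGamma (of_nat n) / fact j) * s ^ j) sums 0" for s
      using sums_Im [OF rGamma_complex_sums [of n s]]
      by (simp only: of_real_power [symmetric] Im_mult_of_real Im_complex_of_real)
  qed simp_all
  then show ?thesis by (simp add: rGamma_coeff_def complex_eq_iff)
qed

lemma summable_norm_scaleR_power: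
  fixes M :: "'a::{real_normed_algebra_1,banach}" and a :: "nat \<Rightarrow> real"
  assumes "summable (\<lambda>j. a j * s ^ j)" and "norm M < s"
  shows "summable (\<lambda>j. norm (a j *\<^sub>R M ^ j))"
proof (rule summable_comparison_test')
  show "summable (\<lambda>j. norm (a j * norm M ^ j))"
    using assms by (intro powser_insidea [of a s]) auto
  show "norm (norm (a j *\<^sub>R M ^ j)) \<le> norm (a j * norm M ^ j)" for j
    by (simp add: abs_mult mult_left_mono norm_power_ineq)
qed

lemma summable_rGamma_shift:
  fixes M :: "'a::{real_normed_algebra_1,banach}"
  shows "summable (\<lambda>j. norm (rGamma_coeff n j *\<^sub>R M ^ j))"
  by (rule summable_norm_scaleR_power [where s = "norm M + 1"])
    (auto intro: sums_summable [OF rGamma_coeff_sums])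

lemma rGamma_shift_sums:
  fixes M :: "'a::{real_normed_algebra_1,banach}"
  shows "(\<lambda>j. rGamma_coeff n j *\<^sub>R M ^ j) sums rGamma_shift n M"
  unfolding rGamma_shift_def by (rule summable_sums [OF summable_norm_cancel [OF summable_rGamma_shift]])

lemma rGamma_shift_commute:
  fixes M X :: "'a::{real_normed_algebra_1,banach}"
  assumes "X * M = M * X"
  shows "X * rGamma_shift n M = rGamma_shift n M * X"
proof (rule sums_unique2)
  show "(\<lambda>j. X * (rGamma_coeff n j *\<^sub>R M ^ j)) sums (X * rGamma_shift n M)"
    by (rule sums_mult [OF rGamma_shift_sums])
  show "(\<lambda>j. X * (rGamma_coeff n j *\<^sub>R M ^ j)) sums (rGamma_shift n M * X)"
    using sums_mult2 [OF rGamma_shift_sums [of n M], of X]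
    by (simp add: power_commuting_commutes [OF assms [symmetric]])
qed

lemma rGamma_shift_Suc:
  fixes M :: "'a::{real_normed_algebra_1,banach}"
  shows "rGamma_shift n M = rGamma_shift (Suc n) M * (M + of_nat n)"
proof -
  let ?a = "\<lambda>j. (case j of 0 \<Rightarrow> 0 | Suc i \<Rightarrow> rGamma_coeff (Suc n) i) + real n * rGamma_coeff (Suc n) j"
  have "?a j = rGamma_coeff n j" for j
  proof (rule real_powser_unique [where r = 1])
    fix s :: real
    have "(\<lambda>j. ?a j *\<^sub>R s ^ j) sums (rGamma (real (Suc n) + s) * (s + of_real (real n)))"
      using rGamma_coeff_sums [of "Suc n" s] by (intro powser_scaleR_mult_linear) simp
    also have "rGamma (real (Suc n) + s) * (s + of_real (real n)) = rGamma (real n + s)"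
      using rGamma_plus1 [of "real n + s"] by (simp add: algebra_simps)
    finally show "(\<lambda>j. ?a j * s ^ j) sums rGamma (real n + s)" by simp
  qed (auto intro: rGamma_coeff_sums)
  then have "(\<lambda>j. rGamma_coeff n j *\<^sub>R M ^ j) sums (rGamma_shift (Suc n) M * (M + of_real (real n)))"
    using powser_scaleR_mult_linear [OF rGamma_shift_sums [of "Suc n" M], of "real n"] by simp
  from sums_unique2 [OF rGamma_shift_sums this] show ?thesis by simp
qed

lemma rGamma_shift_0:
  fixes M :: "'a::{real_normed_algebra_1,banach}"
  shows "rGamma_shift 0 M = rGamma_shift n M * pochhammer_alg M n"
proof (induction n)
  case (Suc n)
  have "rGamma_shift (Suc n) M * (M + of_nat n) * pochhammer_alg M n =
      rGamma_shift (Suc n) M * (pochhammer_alg M n * (M + of_nat n))"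
    unfolding mult.assoc
    by (subst pochhammer_alg_commute [of "M + of_nat n" M n]) (simp_all add: algebra_simps mult_of_nat_commute)
  with Suc rGamma_shift_Suc [of n M] show ?case by simp
qed simp

definition Gamma_coeff :: "real \<Rightarrow> nat \<Rightarrow> real" where
  "Gamma_coeff x j = (LINT t:{0<..}|lborel. exp (- t) * t powr (x - 1) * ln t ^ j / fact j)"

lemma set_integrable_Gamma_exp_ln:
  assumes "0 \<le> m" "m < (x::real)"
  shows "set_integrable lborel {0<..} (\<lambda>t. exp (- t) * t powr (x - 1) * exp (m * \<bar>ln t\<bar>))"
proof -
  have "set_integrable lborel {0<..} (\<lambda>t. exp (- t) * t powr ((x + m) - 1) + exp (- t) * t powr ((x - m) - 1))"
    using set_integrable_Gamma_powr [of "x + m"] set_integrable_Gamma_powr [of "x - m"] assms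
    by (intro set_integral_add) auto
  then show ?thesis
  proof (rule set_integrable_bound)
    show "set_borel_measurable lborel {0<..} (\<lambda>t. exp (- t) * t powr (x - 1) * exp (m * \<bar>ln t\<bar>))"
      unfolding set_borel_measurable_def by measurable
    show "AE t in lborel. t \<in> {0<..} \<longrightarrow> norm (exp (- t) * t powr (x - 1) * exp (m * \<bar>ln t\<bar>))
       \<le> norm (exp (- t) * t powr ((x + m) - 1) + exp (- t) * t powr ((x - m) - 1))"
    proof (intro AE_I2 impI)
      fix t :: real assume "t \<in> {0<..}"
      then have "exp (m * \<bar>ln t\<bar>) \<le> t powr m + t powr (- m)"
        by (auto simp: powr_def abs_if)
      then have "exp (- t) * t powr (x - 1) * exp (m * \<bar>ln t\<bar>) \<le> exp (- t) * t powr (x - 1) * (t powr m + t powr (- m))"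
        by (intro mult_left_mono) auto
      also have "\<dots> = exp (- t) * t powr ((x + m) - 1) + exp (- t) * t powr ((x - m) - 1)"
        by (simp add: distrib_left mult.assoc flip: powr_add) (simp add: algebra_simps)
      finally show "norm (exp (- t) * t powr (x - 1) * exp (m * \<bar>ln t\<bar>))
       \<le> norm (exp (- t) * t powr ((x + m) - 1) + exp (- t) * t powr ((x - m) - 1))"
        by simp
    qed
  qed
qed

lemma sum_exp_terms_le: "0 \<le> (x::real) \<Longrightarrow> (\<Sum>j<k. x ^ j / fact j) \<le> exp x"
  using sum_le_suminf [OF summable_exp_generic [of x], of "{..<k}"]
  by (simp add: exp_def divide_inverse mult.commute)

lemma set_integrable_Gamma_coeff:
  assumes "x > (0::real)"
  shows "set_integrable lborel {0<..} (\<lambda>t. exp (- t) * t powr (x - 1) * ln t ^ j / fact j)"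
proof -
  define m where "m = x / 2"
  have m: "0 < m" "m < x" using assms by (auto simp: m_def)
  have "set_integrable lborel {0<..} (\<lambda>t. (1 / m ^ j) * (exp (- t) * t powr (x - 1) * exp (m * \<bar>ln t\<bar>)))"
    using m by (intro set_integrable_mult_right set_integrable_Gamma_exp_ln) auto
  then show ?thesis
  proof (rule set_integrable_bound)
    show "set_borel_measurable lborel {0<..} (\<lambda>t. exp (- t) * t powr (x - 1) * ln t ^ j / fact j)"
      unfolding set_borel_measurable_def by measurable
    show "AE t in lborel. t \<in> {0<..} \<longrightarrow> norm (exp (- t) * t powr (x - 1) * ln t ^ j / fact j)
       \<le> norm ((1 / m ^ j) * (exp (- t) * t powr (x - 1) * exp (m * \<bar>ln t\<bar>)))"
    proof (intro AE_I2 impI)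
      fix t :: real
      have "(m * \<bar>ln t\<bar>) ^ j / fact j \<le> (\<Sum>i<Suc j. (m * \<bar>ln t\<bar>) ^ i / fact i)"
        using m by (simp add: sum_nonneg)
      also have "\<dots> \<le> exp (m * \<bar>ln t\<bar>)"
        using m by (intro sum_exp_terms_le) auto
      finally have "\<bar>ln t\<bar> ^ j / fact j \<le> (1 / m ^ j) * exp (m * \<bar>ln t\<bar>)"
        using m by (simp add: power_mult_distrib field_simps)
      then have "(exp (- t) * t powr (x - 1)) * (\<bar>ln t\<bar> ^ j / fact j) \<le>
          (exp (- t) * t powr (x - 1)) * ((1 / m ^ j) * exp (m * \<bar>ln t\<bar>))"
        by (intro mult_left_mono) auto
      then show "norm (exp (- t) * t powr (x - 1) * ln t ^ j / fact j)
       \<le> norm ((1 / m ^ j) * (exp (- t) * t powr (x - 1) * exp (m * \<bar>ln t\<bar>)))"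
        using m by (simp add: abs_mult power_abs mult_ac)
    qed
  qed
qed

lemma Gamma_coeff_sums:
  fixes M :: "'a::{real_normed_algebra_1,banach,second_countable_topology}"
  assumes "norm M < x"
  shows "(\<lambda>j. Gamma_coeff x j *\<^sub>R M ^ j) sums Gamma_alg (M + of_real x)"
proof -
  have "x > 0" using assms norm_ge_zero le_less_trans by blast
  let ?I = "\<lambda>t. indicator {0<..} t :: real"
  let ?c = "\<lambda>t j. exp (- t) * t powr (x - 1) * ln t ^ j / fact j"
  let ?s = "\<lambda>k t. \<Sum>j<k. (?I t * ?c t j) *\<^sub>R M ^ j"
  let ?w = "\<lambda>t. ?I t *\<^sub>R (exp (- t) * t powr (x - 1) * exp (norm M * \<bar>ln t\<bar>))"
  have int: "integrable lborel (\<lambda>t. ?I t * ?c t j)" for j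
    using set_integrable_Gamma_coeff [OF \<open>x > 0\<close>, of j] by (simp add: set_integrable_def)
  have "(\<lambda>k. LINT t|lborel. ?s k t) \<longlonglongrightarrow> (LINT t|lborel. ?I t *\<^sub>R Gamma_integrand (M + of_real x) t)"
  proof (rule integral_dominated_convergence [where w = ?w])
    show "integrable lborel ?w"
      using set_integrable_Gamma_exp_ln [of "norm M" x] assms by (simp add: set_integrable_def)
    show "AE t in lborel. (\<lambda>k. ?s k t) \<longlonglongrightarrow> ?I t *\<^sub>R Gamma_integrand (M + of_real x) t"
    proof (rule AE_I2)
      fix t :: real
      have "(\<lambda>j. (ln t *\<^sub>R M) ^ j /\<^sub>R fact j) sums exp (ln t *\<^sub>R M)"
        unfolding exp_def by (rule summable_sums [OF summable_exp_generic])
      then have "(\<lambda>j. (?I t * exp (- t) * t powr (x - 1)) *\<^sub>R ((ln t *\<^sub>R M) ^ j /\<^sub>R fact j)) sums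
          ((?I t * exp (- t) * t powr (x - 1)) *\<^sub>R tpow t M)"
        unfolding tpow_def by (rule sums_scaleR_right)
      also have "(\<lambda>j. (?I t * exp (- t) * t powr (x - 1)) *\<^sub>R ((ln t *\<^sub>R M) ^ j /\<^sub>R fact j)) =
          (\<lambda>j. (?I t * ?c t j) *\<^sub>R M ^ j)"
        by (simp add: scaleR_power divide_inverse mult_ac)
      also have "(?I t * exp (- t) * t powr (x - 1)) *\<^sub>R tpow t M = ?I t *\<^sub>R Gamma_integrand (M + of_real x) t"
        using tpow_add_of_real [of t M "x - 1"] by (cases "t > 0") (auto simp: Gamma_integrand_def algebra_simps)
      finally show "(\<lambda>k. ?s k t) \<longlonglongrightarrow> ?I t *\<^sub>R Gamma_integrand (M + of_real x) t"
        by (simp add: sums_def)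
    qed
    show "AE t in lborel. norm (?s k t) \<le> ?w t" for k
    proof (rule AE_I2)
      fix t :: real
      have "norm (?s k t) \<le> (\<Sum>j<k. (?I t * exp (- t) * t powr (x - 1)) * ((norm M * \<bar>ln t\<bar>) ^ j / fact j))"
      proof (rule sum_norm_le)
        fix j
        have "norm ((?I t * ?c t j) *\<^sub>R M ^ j) \<le> \<bar>?I t * ?c t j\<bar> * norm M ^ j"
          unfolding norm_scaleR by (intro mult_left_mono norm_power_ineq abs_ge_zero)
        also have "\<dots> = (?I t * exp (- t) * t powr (x - 1)) * ((norm M * \<bar>ln t\<bar>) ^ j / fact j)"
          by (simp add: abs_mult power_abs power_mult_distrib)
        finally show "norm ((?I t * ?c t j) *\<^sub>R M ^ j) \<le>
          (?I t * exp (- t) * t powr (x - 1)) * ((norm M * \<bar>ln t\<bar>) ^ j / fact j)" .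
      qed
      also have "\<dots> \<le> (?I t * exp (- t) * t powr (x - 1)) * exp (norm M * \<bar>ln t\<bar>)"
        unfolding sum_distrib_left [symmetric] by (intro mult_left_mono sum_exp_terms_le) auto
      finally show "norm (?s k t) \<le> ?w t" by (simp add: mult_ac)
    qed
  qed measurable
  moreover have "(LINT t|lborel. ?s k t) = (\<Sum>j<k. Gamma_coeff x j *\<^sub>R M ^ j)" for k
  proof -
    have "(LINT t|lborel. ?s k t) = (\<Sum>j<k. (LINT t|lborel. (?I t * ?c t j) *\<^sub>R M ^ j))"
      by (rule Bochner_Integration.integral_sum) (intro integrable_scaleR_left int)
    also have "\<dots> = (\<Sum>j<k. (LINT t|lborel. ?I t * ?c t j) *\<^sub>R M ^ j)"
      by (intro sum.cong refl integral_scaleR_left int)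
    finally show ?thesis by (simp add: Gamma_coeff_def set_lebesgue_integral_def)
  qed
  ultimately show ?thesis
    by (simp add: sums_def Gamma_alg_def set_lebesgue_integral_def)
qed

lemma Gamma_alg_real:
  assumes "x > (0::real)"
  shows "Gamma_alg x = Gamma x"
proof -
  have int: "set_integrable lborel {0<..} (\<lambda>t. exp (- t) * t powr (x - 1))"
    using assms by (rule set_integrable_Gamma_powr)
  have "Gamma_alg x = (LINT t:{0<..}|lborel. exp (- t) * t powr (x - 1))"
    unfolding Gamma_alg_def by (intro set_lebesgue_integral_cong)
      (use tpow_of_real [where 'a = real] in \<open>auto simp: Gamma_integrand_def\<close>)
  also have "\<dots> = integral {0<..} (\<lambda>t. exp (- t) * t powr (x - 1))"
    by (rule set_borel_integral_eq_integral(2) [OF int])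
  also have "\<dots> = integral {0..} (\<lambda>t. exp (- t) * t powr (x - 1))"
    by (rule integral_spike_set; rule negligible_subset [of "{0}"]; auto)
  also have "\<dots> = Gamma x"
    using Gamma_integral_real [OF assms] by (intro integral_unique) (simp add: exp_minus field_simps)
  finally show ?thesis .
qed

lemma Gamma_alg_times_rGamma_shift_sums:
  fixes M :: "'a::{real_normed_algebra_1,banach,second_countable_topology}"
  assumes "norm M < real n"
  shows "(\<lambda>k. (\<Sum>i\<le>k. Gamma_coeff n i * rGamma_coeff n (k - i)) *\<^sub>R M ^ k) sums
    (Gamma_alg (M + of_nat n) * rGamma_shift n M)"
proof -
  obtain s where s: "norm M < s" "s < real n" using assms dense by blast
  then have "norm s < real n" using norm_ge_zero [of M] unfolding real_norm_def by linarith
  from Gamma_coeff_sums [OF this] have "summable (\<lambda>j. Gamma_coeff (real n) j * s ^ j)"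
    by (auto dest: sums_summable)
  then have "summable (\<lambda>j. norm (Gamma_coeff n j *\<^sub>R M ^ j))"
    using s by (intro summable_norm_scaleR_power)
  from Cauchy_product_sums [OF this summable_rGamma_shift [of n M]]
  have "(\<lambda>k. \<Sum>i\<le>k. (Gamma_coeff n i *\<^sub>R M ^ i) * (rGamma_coeff n (k - i) *\<^sub>R M ^ (k - i))) sums
      (Gamma_alg (M + of_nat n) * rGamma_shift n M)"
    using Gamma_coeff_sums [OF assms] by (simp add: sums_iff rGamma_shift_def)
  moreover have "(\<Sum>i\<le>k. (Gamma_coeff n i *\<^sub>R M ^ i) * (rGamma_coeff n (k - i) *\<^sub>R M ^ (k - i))) =
      (\<Sum>i\<le>k. Gamma_coeff n i * rGamma_coeff n (k - i)) *\<^sub>R M ^ k" for k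
    unfolding scaleR_sum_left
    by (intro sum.cong refl) (simp add: power_add [symmetric])
  ultimately show ?thesis by simp
qed

lemma Gamma_alg_times_rGamma_shift:
  fixes M :: "'a::{real_normed_algebra_1,banach,second_countable_topology}"
  assumes "norm M < real n"
  shows "Gamma_alg (M + of_nat n) * rGamma_shift n M = 1"
proof -
  have n: "real n > 0" using assms norm_ge_zero le_less_trans by blast
  have "(\<Sum>i\<le>k. Gamma_coeff n i * rGamma_coeff n (k - i)) = (if k = 0 then 1 else 0)" for k
  proof (rule real_powser_unique [OF n, where f = "\<lambda>_. 1"
        and a = "\<lambda>k. \<Sum>i\<le>k. Gamma_coeff n i * rGamma_coeff n (k - i)" and b = "\<lambda>k. if k = 0 then 1 else 0"])
    fix s :: real assume s: "\<bar>s\<bar> < real n"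
    have "rGamma_shift n s = rGamma (of_nat n + s)"
      using rGamma_coeff_sums [of n s] by (simp add: rGamma_shift_def sums_iff)
    moreover have "Gamma (s + real n) \<noteq> 0"
      using s Gamma_real_pos [of "s + real n"] by linarith
    ultimately have "Gamma_alg (s + of_nat n) * rGamma_shift n s = 1"
      using s by (subst Gamma_alg_real) (auto simp: rGamma_inverse_Gamma add.commute)
    then show "(\<lambda>k. (\<Sum>i\<le>k. Gamma_coeff n i * rGamma_coeff n (k - i)) * s ^ k) sums 1"
      using Gamma_alg_times_rGamma_shift_sums [of s n] s by simp
    show "(\<lambda>k. (if k = 0 then 1 else 0) * s ^ k) sums 1"
      using sums_single [of 0 "\<lambda>k. s ^ k"] by (simp add: if_distrib if_distribR cong: if_cong)
  qed
  then have "(\<lambda>k. (if k = 0 then 1 else 0::real) *\<^sub>R M ^ k) sums (Gamma_alg (M + of_nat n) * rGamma_shift n M)"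
    using Gamma_alg_times_rGamma_shift_sums [OF assms] by simp
  moreover have "(\<lambda>k. (if k = 0 then 1 else 0::real) *\<^sub>R M ^ k) sums 1"
    using sums_single [of 0 "\<lambda>k. M ^ k"] by (simp add: if_distrib if_distribR cong: if_cong)
  ultimately show ?thesis by (rule sums_unique2)
qed

lemma Gamma_alg_times_rGamma_shift_0:
  fixes M :: "'a::{real_normed_algebra_1,banach,second_countable_topology}"
  assumes M: "exp_stable M"
  shows "Gamma_alg M * rGamma_shift 0 M = 1"
proof -
  obtain n where n: "norm M < real n" using reals_Archimedean2 by blast
  have "rGamma_shift 0 M * Gamma_alg M = rGamma_shift n M * (pochhammer_alg M n * Gamma_alg M)"
    by (simp add: rGamma_shift_0 [of M n] mult.assoc)
  also have "\<dots> = Gamma_alg (M + of_nat n) * rGamma_shift n M"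
    unfolding Gamma_alg_add_of_nat [OF M, symmetric]
    by (rule Gamma_alg_commute [OF exp_stable_add_of_nat [OF M]], rule sym)
      (simp add: rGamma_shift_commute algebra_simps mult_of_nat_commute)
  also have "\<dots> = 1" by (rule Gamma_alg_times_rGamma_shift [OF n])
  finally have "rGamma_shift 0 M * Gamma_alg M = 1" .
  moreover have "Gamma_alg M * rGamma_shift 0 M = rGamma_shift 0 M * Gamma_alg M"
    by (rule rGamma_shift_commute) (simp add: Gamma_alg_commute [OF M])
  ultimately show ?thesis by simp
qed

section \<open>The Beta Integral\<close>

definition Beta_integrand :: "'a::{real_normed_algebra_1,banach} \<Rightarrow> 'a \<Rightarrow> real \<Rightarrow> 'a" where
  "Beta_integrand C E t = tpow t (C - 1) * tpow (1 - t) (E - 1)"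

definition Beta_alg :: "'a::{real_normed_algebra_1,banach,second_countable_topology} \<Rightarrow> 'a \<Rightarrow> 'a" where
  "Beta_alg C E = (LINT t:{0<..<1}|lborel. Beta_integrand C E t)"

lemma measurable_Beta_integrand [measurable]:
  fixes C E :: "'a::{real_normed_algebra_1,banach,second_countable_topology}"
  shows "Beta_integrand C E \<in> borel_measurable borel"
  unfolding Beta_integrand_def by measurable

lemma set_integrable_Beta_integrand:
  fixes C E :: "'a::{real_normed_algebra_1,banach,second_countable_topology}"
  assumes "exp_stable C" "exp_stable E"
  shows "set_integrable lborel {0<..<1} (Beta_integrand C E)"
proof -
  obtain K a where a: "a > 0" "K \<ge> 0"
    "\<And>t. 0 < t \<Longrightarrow> t < 1 \<Longrightarrow> norm (tpow t (C - 1)) \<le> K * t powr (a - 1)"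
    using assms(1) by (rule exp_stableE') blast
  obtain L b where b: "b > 0" "L \<ge> 0"
    "\<And>t. 0 < t \<Longrightarrow> t < 1 \<Longrightarrow> norm (tpow t (E - 1)) \<le> L * t powr (b - 1)"
    using assms(2) by (rule exp_stableE') blast
  have "set_integrable lborel {0<..<1} (\<lambda>t. t powr (a - 1) * (1 - t) powr (b - 1))"
    by (rule set_integrable_subset [OF integrable_Beta]) (use a b in auto)
  then have "set_integrable lborel {0<..<1} (\<lambda>t. (K * L) * (t powr (a - 1) * (1 - t) powr (b - 1)))"
    by (rule set_integrable_mult_right_alg)
  then show ?thesis
  proof (rule set_integrable_bound)
    show "set_borel_measurable lborel {0<..<1} (Beta_integrand C E)"
      unfolding set_borel_measurable_def by measurable
    show "AE t in lborel. t \<in> {0<..<1} \<longrightarrow> norm (Beta_integrand C E t)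
       \<le> norm ((K * L) * (t powr (a - 1) * (1 - t) powr (b - 1)))"
    proof (intro AE_I2 impI)
      fix t :: real assume t: "t \<in> {0<..<1}"
      have "norm (Beta_integrand C E t) \<le> norm (tpow t (C - 1)) * norm (tpow (1 - t) (E - 1))"
        unfolding Beta_integrand_def by (rule norm_mult_ineq)
      also have "\<dots> \<le> (K * t powr (a - 1)) * (L * (1 - t) powr (b - 1))"
        using a b t by (intro mult_mono) auto
      finally show "norm (Beta_integrand C E t) \<le> norm ((K * L) * (t powr (a - 1) * (1 - t) powr (b - 1)))"
        using a b by (simp add: abs_mult mult_ac)
    qed
  qed
qed

lemma integrable_convolution:
  fixes F G :: "real \<Rightarrow> 'a::{real_normed_algebra_1,banach,second_countable_topology}"
  assumes F: "integrable lborel F" and G: "integrable lborel G"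
  shows "integrable (lborel \<Otimes>\<^sub>M lborel) (\<lambda>(x, u). F x * G (u - x))"
proof (rule lborel_pair.Fubini_integrable)
  have [measurable]: "F \<in> borel_measurable borel" "G \<in> borel_measurable borel"
    using F G by (auto dest: borel_measurable_integrable)
  have trans: "integrable lborel (\<lambda>u. G (u - x))" for x
    using lborel_integrable_real_affine [OF G, of 1 "- x"] by (simp add: algebra_simps)
  have trans_norm: "(LINT u|lborel. norm (G (u - x))) = (LINT u|lborel. norm (G u))" for x
    using lborel_integral_real_affine [of 1 "\<lambda>u. norm (G u)" "- x"] by (simp add: algebra_simps)
  have int: "integrable lborel (\<lambda>u. F x * G (u - x))" for x
    by (rule integrable_mult_right) (rule trans)
  show "(\<lambda>(x, u). F x * G (u - x)) \<in> borel_measurable (lborel \<Otimes>\<^sub>M lborel)"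
    by measurable
  show "AE x in lborel. integrable lborel (\<lambda>u. case (x, u) of (x, u) \<Rightarrow> F x * G (u - x))"
    using int by simp
  show "integrable lborel (\<lambda>x. LINT u|lborel. norm (case (x, u) of (x, u) \<Rightarrow> F x * G (u - x)))"
  proof (rule Bochner_Integration.integrable_bound)
    show "integrable lborel (\<lambda>x. norm (F x) * (LINT u|lborel. norm (G u)))"
      using F by simp
    show "AE x in lborel. norm (LINT u|lborel. norm (case (x, u) of (x, u) \<Rightarrow> F x * G (u - x))) \<le>
        norm (norm (F x) * (LINT u|lborel. norm (G u)))"
    proof (rule AE_I2)
      fix x
      have "(LINT u|lborel. norm (F x * G (u - x))) \<le> (LINT u|lborel. norm (F x) * norm (G (u - x)))"
        using int trans by (intro integral_mono) (auto intro: norm_mult_ineq)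
      also have "\<dots> = norm (F x) * (LINT u|lborel. norm (G u))"
        by (simp add: trans_norm)
      finally show "norm (LINT u|lborel. norm (case (x, u) of (x, u) \<Rightarrow> F x * G (u - x))) \<le>
        norm (norm (F x) * (LINT u|lborel. norm (G u)))"
        by simp
    qed
  qed measurable
qed

lemma integral_convolution:
  fixes F G :: "real \<Rightarrow> 'a::{real_normed_algebra_1,banach,second_countable_topology}"
  assumes F: "integrable lborel F" and G: "integrable lborel G"
  shows "(LINT u|lborel. LINT x|lborel. F x * G (u - x)) = (LINT x|lborel. F x) * (LINT y|lborel. G y)"
proof -
  have "(LINT u|lborel. LINT x|lborel. F x * G (u - x)) = (LINT x|lborel. LINT u|lborel. F x * G (u - x))"
    using integrable_convolution [OF F G] by (rule lborel_pair.Fubini_integral)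
  also have "\<dots> = (LINT x|lborel. F x * (LINT y|lborel. G y))"
  proof (rule Bochner_Integration.integral_cong [OF refl])
    fix x
    have "integrable lborel (\<lambda>u. G (u - x))"
      using lborel_integrable_real_affine [OF G, of 1 "- x"] by (simp add: algebra_simps)
    then have "(LINT u|lborel. F x * G (u - x)) = F x * (LINT u|lborel. G (u - x))"
      by (rule Bochner_Integration.integral_mult_right)
    also have "(LINT u|lborel. G (u - x)) = (LINT u|lborel. G u)"
      using lborel_integral_real_affine [of 1 G "- x"] by (simp add: algebra_simps)
    finally show "(LINT u|lborel. F x * G (u - x)) = F x * (LINT y|lborel. G y)" .
  qed
  also have "\<dots> = (LINT x|lborel. F x) * (LINT y|lborel. G y)"
    by (rule Bochner_Integration.integral_mult_left) (rule F)
  finally show ?thesis .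
qed

lemma Gamma_integrand_convolution:
  fixes C E :: "'a::{real_normed_algebra_1,banach,second_countable_topology}"
  assumes C: "exp_stable C" and E: "exp_stable E" and comm: "C * E = E * C" and "u > 0"
  shows "(LINT x|lborel. (indicator {0<..} x *\<^sub>R Gamma_integrand C x) *
      (indicator {0<..} (u - x) *\<^sub>R Gamma_integrand E (u - x))) = Beta_alg C E * Gamma_integrand (C + E) u"
proof -
  let ?I = "\<lambda>t. indicator {0<..} t :: real"
  have comm1: "(C - 1) * (E - 1) = (E - 1) * (C - 1)"
    using comm by (simp add: algebra_simps)
  have swap: "tpow s (C - 1) * tpow t (E - 1) = tpow t (E - 1) * tpow s (C - 1)" for s t
    by (rule tpow_commute, rule tpow_commute [symmetric]) (rule comm1 [symmetric])
  have eq: "(?I (u * t) *\<^sub>R Gamma_integrand C (u * t)) * (?I (u - u * t) *\<^sub>R Gamma_integrand E (u - u * t)) =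
      (indicator {0<..<1} t *\<^sub>R Beta_integrand C E t) * (exp (- u) *\<^sub>R (tpow u (C - 1) * tpow u (E - 1)))" for t
  proof (cases "0 < t \<and> t < 1")
    case True
    then have I: "?I (u * t) = 1" "?I (u - u * t) = 1" "indicator {0<..<1} t = (1::real)"
      using \<open>u > 0\<close> by (auto simp: indicator_def)
    have sub: "u - t * u = (1 - t) * u" by (simp add: algebra_simps)
    have "Gamma_integrand C (u * t) * Gamma_integrand E (u - u * t) =
        (exp (- (u * t)) * exp (- (u - u * t))) *\<^sub>R (tpow (t * u) (C - 1) * tpow ((1 - t) * u) (E - 1))"
      unfolding Gamma_integrand_def mult.commute [of u t] sub
      by (simp only: mult_scaleR_left mult_scaleR_right scaleR_scaleR mult.commute)
    also have "exp (- (u * t)) * exp (- (u - u * t)) = exp (- u)"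
      by (simp flip: exp_add)
    also have "tpow (t * u) (C - 1) * tpow ((1 - t) * u) (E - 1) =
        tpow t (C - 1) * (tpow u (C - 1) * tpow (1 - t) (E - 1)) * tpow u (E - 1)"
      using True \<open>u > 0\<close> by (simp add: tpow_mult mult.assoc)
    also have "\<dots> = Beta_integrand C E t * (tpow u (C - 1) * tpow u (E - 1))"
      unfolding swap [of u "1 - t"] by (simp add: Beta_integrand_def mult.assoc)
    finally show ?thesis by (simp add: I)
  next
    case False
    then show ?thesis using \<open>u > 0\<close> by (auto simp: indicator_def zero_less_mult_iff)
  qed
  have mult: "tpow u (C - 1) * tpow u (E - 1) = (1 / u) *\<^sub>R tpow u (C + E - 1)"
    using \<open>u > 0\<close> tpow_diff_1 [of u "C + E - 1"]
    by (simp add: algebra_simps flip: tpow_add [OF comm1])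
  have "(LINT x|lborel. (?I x *\<^sub>R Gamma_integrand C x) * (?I (u - x) *\<^sub>R Gamma_integrand E (u - x))) =
      u *\<^sub>R (LINT t|lborel. (indicator {0<..<1} t *\<^sub>R Beta_integrand C E t) *
        (exp (- u) *\<^sub>R (tpow u (C - 1) * tpow u (E - 1))))"
    using \<open>u > 0\<close> by (subst lborel_integral_real_affine [where c = u and t = 0]) (simp_all only: eq add_0 abs_of_pos)
  also have "\<dots> = u *\<^sub>R (Beta_alg C E * (exp (- u) *\<^sub>R (tpow u (C - 1) * tpow u (E - 1))))"
    using set_integrable_Beta_integrand [OF C E] unfolding set_integrable_def Beta_alg_def set_lebesgue_integral_def
    by (subst Bochner_Integration.integral_mult_left) simp_all
  also have "\<dots> = Beta_alg C E * Gamma_integrand (C + E) u"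
    using \<open>u > 0\<close> by (simp add: mult Gamma_integrand_def)
  finally show ?thesis .
qed

lemma Gamma_alg_times_Gamma_alg:
  fixes C E :: "'a::{real_normed_algebra_1,banach,second_countable_topology}"
  assumes C: "exp_stable C" and E: "exp_stable E" and CE: "exp_stable (C + E)" and comm: "C * E = E * C"
  shows "Gamma_alg C * Gamma_alg E = Beta_alg C E * Gamma_alg (C + E)"
proof -
  let ?F = "\<lambda>M t. indicator {0<..} t *\<^sub>R Gamma_integrand M t"
  have int: "integrable lborel (?F M)" if "exp_stable M" for M :: 'a
    using set_integrable_Gamma_integrand [OF that] by (simp add: set_integrable_def)
  have "Gamma_alg C * Gamma_alg E = (LINT u|lborel. LINT x|lborel. ?F C x * ?F E (u - x))"
    unfolding integral_convolution [OF int [OF C] int [OF E]]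
    by (simp add: Gamma_alg_def set_lebesgue_integral_def)
  also have "\<dots> = (LINT u|lborel. Beta_alg C E * ?F (C + E) u)"
  proof (rule Bochner_Integration.integral_cong [OF refl])
    fix u :: real
    show "(LINT x|lborel. ?F C x * ?F E (u - x)) = Beta_alg C E * ?F (C + E) u"
    proof (cases "u > 0")
      case True
      then show ?thesis using Gamma_integrand_convolution [OF C E comm True] by simp
    next
      case False
      then have "?F C x * ?F E (u - x) = 0" for x by (auto simp: indicator_def)
      then show ?thesis using False by (simp only: Bochner_Integration.integral_zero) simp
    qed
  qed
  also have "\<dots> = Beta_alg C E * Gamma_alg (C + E)"
    unfolding Gamma_alg_def set_lebesgue_integral_def
    by (rule Bochner_Integration.integral_mult_right) (rule int [OF CE])
  finally show ?thesis .
qed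

section \<open>Termwise Integration of the Series\<close>

lemma Beta_alg_add_of_nat:
  fixes C D :: "'a::{real_normed_algebra_1,banach,second_countable_topology}"
  assumes C: "exp_stable C" and D: "exp_stable D" and DC: "exp_stable (D - C)" and comm: "C * D = D * C"
  shows "Beta_alg (C + of_nat n) (D - C) * Gamma_alg D * rGamma_shift 0 C * rGamma_shift 0 (D - C)
    * pochhammer_alg D n = pochhammer_alg C n"
proof -
  define E where "E = D - C"
  define B where "B = Beta_alg (C + of_nat n) E"
  have E: "exp_stable E" using DC by (simp add: E_def)
  have CE: "C * E = E * C" and DE: "D * E = E * D"
    using comm by (simp_all add: E_def algebra_simps)
  have "Gamma_alg (C + of_nat n) * Gamma_alg E = B * Gamma_alg (C + of_nat n + E)"
    unfolding B_def
  proof (rule Gamma_alg_times_Gamma_alg)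
    show "exp_stable (C + of_nat n + E)"
      using exp_stable_add_of_nat [OF D, of n] by (simp add: E_def algebra_simps)
    show "(C + of_nat n) * E = E * (C + of_nat n)"
      using CE by (simp add: algebra_simps mult_of_nat_commute)
  qed (intro exp_stable_add_of_nat C E)+
  also have "C + of_nat n + E = D + of_nat n" by (simp add: E_def)
  finally have BG: "pochhammer_alg C n * Gamma_alg C * Gamma_alg E = B * (pochhammer_alg D n * Gamma_alg D)"
    by (simp add: Gamma_alg_add_of_nat C D)
  let ?rC = "rGamma_shift 0 C" and ?rE = "rGamma_shift 0 E" and ?p = "pochhammer_alg D n"
  have pG: "Gamma_alg D * ?p = ?p * Gamma_alg D"
    by (rule pochhammer_alg_commute) (simp add: Gamma_alg_commute [OF D])
  have pC: "?rC * ?p = ?p * ?rC"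
    by (rule pochhammer_alg_commute) (simp add: rGamma_shift_commute comm)
  have pE: "?rE * ?p = ?p * ?rE"
    by (rule pochhammer_alg_commute) (simp add: rGamma_shift_commute DE)
  have EC: "?rC * Gamma_alg E = Gamma_alg E * ?rC"
    by (rule Gamma_alg_commute [OF E], rule rGamma_shift_commute [symmetric]) (simp add: CE)
  have "B * Gamma_alg D * ?rC * ?rE * ?p = B * Gamma_alg D * (?rC * ?p) * ?rE"
    by (simp only: mult.assoc pE)
  also have "\<dots> = B * (Gamma_alg D * ?p) * ?rC * ?rE"
    by (simp only: pC mult.assoc)
  also have "\<dots> = B * (?p * Gamma_alg D) * ?rC * ?rE"
    by (simp only: pG)
  also have "\<dots> = pochhammer_alg C n * Gamma_alg C * (Gamma_alg E * ?rC) * ?rE"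
    by (simp only: BG [symmetric] mult.assoc)
  also have "\<dots> = pochhammer_alg C n * (Gamma_alg C * ?rC) * (Gamma_alg E * ?rE)"
    by (simp only: EC [symmetric] mult.assoc)
  also have "\<dots> = pochhammer_alg C n"
    by (simp add: Gamma_alg_times_rGamma_shift_0 C E)
  finally show ?thesis by (simp add: B_def E_def)
qed

lemma pochhammer_alg_right_inverse:
  fixes M :: "'a::{real_normed_algebra_1,banach,second_countable_topology}"
  assumes "exp_stable M"
  shows "\<exists>N. pochhammer_alg M n * N = 1"
proof -
  have "pochhammer_alg M n * (Gamma_alg M * rGamma_shift 0 (M + of_nat n)) = 1"
    using Gamma_alg_times_rGamma_shift_0 [OF exp_stable_add_of_nat [OF assms, of n]]
    by (simp add: Gamma_alg_add_of_nat [OF assms] mult.assoc)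
  then show ?thesis by blast
qed

lemma exp_stable_inverse_add_of_nat:
  fixes M :: "'a::{real_normed_algebra_1,banach,second_countable_topology}"
  assumes M: "exp_stable M"
  shows "\<exists>N. (M + of_nat k) * N = 1 \<and> N * (M + of_nat k) = 1"
proof -
  let ?M = "M + of_nat k"
  have stable: "exp_stable ?M" by (rule exp_stable_add_of_nat [OF M])
  have stable': "exp_stable (?M + 1)" using exp_stable_add_of_nat [OF stable, of 1] by simp
  have 1: "?M * (Gamma_alg ?M * rGamma_shift 0 (?M + 1)) = 1"
    using Gamma_alg_times_rGamma_shift_0 [OF stable'] Gamma_alg_add_1 [OF stable] by (simp add: mult.assoc)
  have a: "?M * Gamma_alg ?M = Gamma_alg ?M * ?M"
    by (rule Gamma_alg_commute [OF stable refl])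
  have b: "?M * rGamma_shift 0 (?M + 1) = rGamma_shift 0 (?M + 1) * ?M"
    by (rule rGamma_shift_commute) (simp add: algebra_simps)
  have "(Gamma_alg ?M * rGamma_shift 0 (?M + 1)) * ?M = Gamma_alg ?M * ?M * rGamma_shift 0 (?M + 1)"
    by (simp only: mult.assoc b)
  also have "\<dots> = ?M * (Gamma_alg ?M * rGamma_shift 0 (?M + 1))"
    by (simp only: a [symmetric] mult.assoc)
  finally have "(Gamma_alg ?M * rGamma_shift 0 (?M + 1)) * ?M = ?M * (Gamma_alg ?M * rGamma_shift 0 (?M + 1))" .
  with 1 show ?thesis by auto
qed

text \<open>\<open>S\<^sub>n = T\<^sub>n P\<^sub>n\<close> with \<open>P\<^sub>n = (D)\<^sub>n (C)\<^sub>n\<^sup>-\<^sup>1\<close>, and \<open>P\<^sub>n\<close> grows subexponentially because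
  \<open>(D + n)(C + n)\<^sup>-\<^sup>1 = 1 + (D - C)(C + n)\<^sup>-\<^sup>1 \<longrightarrow> 1\<close>.\<close>

lemma summable_norm_pochhammer_quotient:
  fixes C D :: "'a::{real_normed_algebra_1,banach,second_countable_topology}"
  assumes C: "exp_stable C" and comm: "C * D = D * C" and "\<rho> > 1"
    and bound: "\<And>n. norm (T n) * \<rho> ^ n \<le> K"
    and T: "\<And>n. T n * pochhammer_alg D n = S n * pochhammer_alg C n"
  shows "summable (\<lambda>n. norm (S n))"
proof -
  obtain N where N: "(C + of_nat k) * N k = 1" "N k * (C + of_nat k) = 1" for k
    using exp_stable_inverse_add_of_nat [OF C] by metis
  define P where "P = rec_nat 1 (\<lambda>n x. x * ((D + of_nat n) * N n))"
  have P_0: "P 0 = 1" and P_Suc: "P (Suc n) = P n * ((D + of_nat n) * N n)" for n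
    by (simp_all add: P_def)
  have P: "P n * pochhammer_alg C n = pochhammer_alg D n" for n
  proof (induction n)
    case (Suc n)
    have c1: "(C + of_nat n) * pochhammer_alg C n = pochhammer_alg C n * (C + of_nat n)"
      by (rule pochhammer_alg_commute) (simp add: algebra_simps mult_of_nat_commute)
    have c2: "(D + of_nat n) * pochhammer_alg C n = pochhammer_alg C n * (D + of_nat n)"
      by (rule pochhammer_alg_commute) (simp add: algebra_simps mult_of_nat_commute comm)
    have "P (Suc n) * pochhammer_alg C (Suc n) =
        P n * (D + of_nat n) * (N n * (C + of_nat n)) * pochhammer_alg C n"
      by (simp add: P_Suc c1 [symmetric] mult.assoc)
    also have "\<dots> = P n * pochhammer_alg C n * (D + of_nat n)"
      by (simp add: N c2 mult.assoc)
    finally show ?case by (simp add: Suc)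
  qed (simp add: P_0)
  have S: "S n = T n * P n" for n
  proof -
    obtain R where R: "pochhammer_alg C n * R = 1"
      using pochhammer_alg_right_inverse [OF C] by blast
    have "S n * pochhammer_alg C n = T n * P n * pochhammer_alg C n"
      by (simp only: T [symmetric] P [symmetric] mult.assoc)
    then have "S n * pochhammer_alg C n * R = T n * P n * pochhammer_alg C n * R" by simp
    then show ?thesis by (simp add: R mult.assoc)
  qed
  obtain c where c: "1 / \<rho> < c" "c < 1" using \<open>\<rho> > 1\<close> dense [of "1 / \<rho>" 1] by auto
  define \<delta> where "\<delta> = c * \<rho> - 1"
  have "\<delta> > 0" using c \<open>\<rho> > 1\<close> by (simp add: \<delta>_def field_simps)
  obtain n0 where n0: "norm C + norm (D - C) / \<delta> < real n0" using reals_Archimedean2 by blast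
  have step: "1 + norm (D - C) * norm (N n) \<le> c * \<rho>" if "n \<ge> n0" for n
  proof -
    have "of_nat n * N n = 1 - C * N n"
      using N(1) [of n] by (simp add: algebra_simps)
    then have "real n *\<^sub>R N n = 1 - C * N n" by (simp add: scaleR_conv_of_real)
    then have "real n * norm (N n) = norm (1 - C * N n)"
      by (metis abs_of_nat norm_scaleR)
    also have "\<dots> \<le> 1 + norm C * norm (N n)"
      using norm_triangle_ineq4 [of 1 "C * N n"] norm_mult_ineq [of C "N n"] by simp
    finally have 1: "(real n - norm C) * norm (N n) \<le> 1" by (simp add: algebra_simps)
    have "norm (D - C) / \<delta> \<le> real n - norm C" using n0 that by simp
    then have "norm (D - C) \<le> \<delta> * (real n - norm C)"
      using \<open>\<delta> > 0\<close> by (simp add: field_simps)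
    then have "norm (D - C) * norm (N n) \<le> \<delta> * ((real n - norm C) * norm (N n))"
      unfolding mult.assoc [symmetric] by (rule mult_right_mono) simp
    also have "\<dots> \<le> \<delta>" using 1 \<open>\<delta> > 0\<close> by (simp add: mult_left_le)
    finally show ?thesis by (simp add: \<delta>_def)
  qed
  have "summable (\<lambda>n. norm (P n) / \<rho> ^ n)"
  proof (rule summable_ratio_test [OF c(2), of n0])
    fix n assume n: "n \<ge> n0"
    have "(D + of_nat n) * N n = 1 + (D - C) * N n"
      using N(1) [of n] by (simp add: algebra_simps)
    then have "norm ((D + of_nat n) * N n) \<le> 1 + norm (D - C) * norm (N n)"
      using norm_triangle_ineq [of 1 "(D - C) * N n"] norm_mult_ineq [of "D - C" "N n"] by simp
    also have "\<dots> \<le> c * \<rho>" by (rule step [OF n])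
    finally have "norm (P n) * norm ((D + of_nat n) * N n) \<le> norm (P n) * (c * \<rho>)"
      by (rule mult_left_mono) simp
    then have "norm (P (Suc n)) \<le> norm (P n) * (c * \<rho>)"
      unfolding P_Suc using norm_mult_ineq order_trans by blast
    then show "norm (norm (P (Suc n)) / \<rho> ^ Suc n) \<le> c * norm (norm (P n) / \<rho> ^ n)"
      using \<open>\<rho> > 1\<close> by (simp add: field_simps)
  qed
  then have "summable (\<lambda>n. K * (norm (P n) / \<rho> ^ n))" by (rule summable_mult)
  then show ?thesis
  proof (rule summable_comparison_test')
    fix n
    have "norm (S n) \<le> norm (T n) * norm (P n)" unfolding S by (rule norm_mult_ineq)
    also have "\<dots> \<le> (K / \<rho> ^ n) * norm (P n)"
      using bound [of n] \<open>\<rho> > 1\<close> by (intro mult_right_mono) (simp_all add: field_simps)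
    finally show "norm (norm (S n)) \<le> K * (norm (P n) / \<rho> ^ n)" by simp
  qed
qed

lemma
  fixes C D :: "'a::{real_normed_algebra_1,banach,second_countable_topology}"
  assumes C: "exp_stable C" and D: "exp_stable D" and DC: "exp_stable (D - C)" and comm: "C * D = D * C"
    and S: "summable (\<lambda>n. norm (S n))" and Q: "\<And>n. pochhammer_alg D n * Q n = 1"
  defines "f \<equiv> \<lambda>t. (\<Sum>n. t ^ n *\<^sub>R S n) * Beta_integrand C (D - C) t"
  shows set_integrable_series_Beta: "set_integrable lborel {0<..<1} f"
    and sums_integral_series_Beta: "(\<lambda>n. S n * pochhammer_alg C n * Q n) sums
      ((LINT t:{0<..<1}|lborel. f t) * Gamma_alg D * rGamma_shift 0 C * rGamma_shift 0 (D - C))"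
proof -
  let ?I = "\<lambda>t. indicator {0<..<1} t :: real" and ?b = "Beta_integrand C (D - C)"
  let ?s = "\<lambda>k t. ?I t *\<^sub>R ((\<Sum>n<k. t ^ n *\<^sub>R S n) * ?b t)"
  let ?w = "\<lambda>t. (\<Sum>n. norm (S n)) * norm (?I t *\<^sub>R ?b t)"
  have norm_le: "norm (t ^ n *\<^sub>R S n) \<le> norm (S n)" if "t \<in> {0<..<1}" for t n
    using that by (simp add: power_le_one mult_left_le_one_le)
  have lim: "(\<lambda>k. ?s k t) \<longlonglongrightarrow> ?I t *\<^sub>R f t" for t
  proof (cases "t \<in> {0<..<1}")
    case True
    have "summable (\<lambda>n. t ^ n *\<^sub>R S n)"
      by (rule summable_comparison_test' [OF S norm_le [OF True]])
    then show ?thesis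
      unfolding f_def by (intro tendsto_scaleR tendsto_mult tendsto_const summable_LIMSEQ)
  qed simp
  have bound: "norm (?s k t) \<le> ?w t" for k t
  proof (cases "t \<in> {0<..<1}")
    case True
    have "norm (\<Sum>n<k. t ^ n *\<^sub>R S n) \<le> (\<Sum>n<k. norm (S n))"
      by (intro sum_norm_le norm_le True)
    also have "\<dots> \<le> (\<Sum>n. norm (S n))" by (intro sum_le_suminf S) auto
    finally have "norm ((\<Sum>n<k. t ^ n *\<^sub>R S n) * ?b t) \<le> (\<Sum>n. norm (S n)) * norm (?b t)"
      by (meson mult_right_mono norm_ge_zero norm_mult_ineq order_trans)
    then show ?thesis using True by simp
  qed simp
  have w: "integrable lborel ?w"
    using set_integrable_Beta_integrand [OF C DC] unfolding set_integrable_def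
    by (intro integrable_mult_right integrable_norm)
  have [measurable]: "?s k \<in> borel_measurable borel" for k by measurable
  have [measurable]: "(\<lambda>t. ?I t *\<^sub>R f t) \<in> borel_measurable borel"
    by (rule borel_measurable_LIMSEQ_metric [of ?s]) (use lim in auto)
  show "set_integrable lborel {0<..<1} f"
    unfolding set_integrable_def
    by (rule integrable_dominated_convergence [of _ _ ?s ?w]) (use lim bound w in auto)
  have "(\<lambda>k. LINT t|lborel. ?s k t) \<longlonglongrightarrow> (LINT t|lborel. ?I t *\<^sub>R f t)"
    by (rule integral_dominated_convergence [of _ _ ?s ?w]) (use lim bound w in auto)
  moreover have "(LINT t|lborel. ?s k t) = (\<Sum>n<k. S n * Beta_alg (C + of_nat n) (D - C))" for k
  proof -
    have eq: "?I t *\<^sub>R Beta_integrand (C + of_nat n) (D - C) t = ?I t *\<^sub>R (t ^ n *\<^sub>R ?b t)" for n t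
      using tpow_add_of_nat [of t "C - 1" n]
      by (cases "t \<in> {0<..<1}") (simp_all add: Beta_integrand_def algebra_simps)
    have int: "integrable lborel (\<lambda>t. ?I t *\<^sub>R Beta_integrand (C + of_nat n) (D - C) t)" for n
      using set_integrable_Beta_integrand [OF exp_stable_add_of_nat [OF C] DC] by (simp add: set_integrable_def)
    have "(LINT t|lborel. ?s k t) = (LINT t|lborel. (\<Sum>n<k. S n * (?I t *\<^sub>R Beta_integrand (C + of_nat n) (D - C) t)))"
      by (simp add: eq sum_distrib_right scaleR_sum_right)
    also have "\<dots> = (\<Sum>n<k. (LINT t|lborel. S n * (?I t *\<^sub>R Beta_integrand (C + of_nat n) (D - C) t)))"
      by (rule Bochner_Integration.integral_sum) (rule integrable_mult_right, rule int)
    also have "\<dots> = (\<Sum>n<k. S n * Beta_alg (C + of_nat n) (D - C))"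
      unfolding Beta_alg_def set_lebesgue_integral_def
      by (rule sum.cong [OF refl], rule Bochner_Integration.integral_mult_right, rule int)
    finally show ?thesis .
  qed
  ultimately have sums: "(\<lambda>n. S n * Beta_alg (C + of_nat n) (D - C)) sums (LINT t:{0<..<1}|lborel. f t)"
    by (simp add: sums_def set_lebesgue_integral_def)
  let ?G = "Gamma_alg D * rGamma_shift 0 C * rGamma_shift 0 (D - C)"
  have "Beta_alg (C + of_nat n) (D - C) * ?G = pochhammer_alg C n * Q n" for n
  proof -
    have "Beta_alg (C + of_nat n) (D - C) * ?G * pochhammer_alg D n * Q n = pochhammer_alg C n * Q n"
      using Beta_alg_add_of_nat [OF C D DC comm, of n] by (simp add: mult.assoc)
    then show ?thesis by (simp add: Q mult.assoc)
  qed
  then have "S n * Beta_alg (C + of_nat n) (D - C) * ?G = S n * pochhammer_alg C n * Q n" for n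
    by (simp add: mult.assoc)
  with sums_mult2 [OF sums, of ?G]
  show "(\<lambda>n. S n * pochhammer_alg C n * Q n) sums
      ((LINT t:{0<..<1}|lborel. f t) * Gamma_alg D * rGamma_shift 0 C * rGamma_shift 0 (D - C))"
    by (simp add: mult.assoc)
qed

section \<open>Complex Matrices as a Banach Algebra\<close>

text \<open>
  A copy of the matrix type is needed because there the multiplication is entrywise and the
  Euclidean norm of the identity matrix is not 1.
\<close>

typedef ('n::finite) cmat = "UNIV :: (complex^'n^'n) set"
  morphisms matrix_of_cmat cmat
  by simp

setup_lifting type_definition_cmat

lemma scaleR_matrix_mult_left: "(r *\<^sub>R A) ** B = r *\<^sub>R (A ** B)" for A B :: "complex^'n^'n"
  by (simp add: vec_eq_iff matrix_matrix_mult_def scaleR_sum_right)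

lemma scaleR_matrix_mult_right: "A ** (r *\<^sub>R B) = r *\<^sub>R (A ** B)" for A B :: "complex^'n^'n"
  by (simp add: vec_eq_iff matrix_matrix_mult_def scaleR_sum_right)

lemma scaleR_matrix_vector_mult: "(r *\<^sub>R A) *v x = r *\<^sub>R (A *v x)" for A :: "complex^'n^'n"
  by (simp add: vec_eq_iff matrix_vector_mult_def scaleR_sum_right)

lemma matrix_matrix_mult_add_rdistrib: "(A + B) ** C = A ** C + B ** C" for A B C :: "complex^'n^'n"
  by (simp add: vec_eq_iff matrix_matrix_mult_def sum.distrib distrib_right)

lemma onorm_matrix_eq_0: "onorm ((*v) A) = 0 \<longleftrightarrow> A = 0" for A :: "complex^'n^'n"
  by (simp add: onorm_eq_0 matrix_eq)

instantiation cmat :: (finite) real_vector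
begin

lift_definition zero_cmat :: "'a cmat" is 0 .
lift_definition plus_cmat :: "'a cmat \<Rightarrow> 'a cmat \<Rightarrow> 'a cmat" is "(+)" .
lift_definition minus_cmat :: "'a cmat \<Rightarrow> 'a cmat \<Rightarrow> 'a cmat" is "(-)" .
lift_definition uminus_cmat :: "'a cmat \<Rightarrow> 'a cmat" is "uminus" .
lift_definition scaleR_cmat :: "real \<Rightarrow> 'a cmat \<Rightarrow> 'a cmat" is "(*\<^sub>R)" .

instance
proof
  fix A B C :: "'a cmat" and r s :: real
  show "A + B + C = A + (B + C)" "A + B = B + A" "0 + A = A" "- A + A = 0" "A - B = A + - B"
    by (transfer, simp)+
  show "r *\<^sub>R (A + B) = r *\<^sub>R A + r *\<^sub>R B" "(r + s) *\<^sub>R A = r *\<^sub>R A + s *\<^sub>R A"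
    "r *\<^sub>R s *\<^sub>R A = (r * s) *\<^sub>R A" "1 *\<^sub>R A = A"
    by (transfer, simp add: algebra_simps)+
qed

end

instantiation cmat :: (finite) real_normed_algebra_1
begin

lift_definition one_cmat :: "'a cmat" is "mat 1" .
lift_definition times_cmat :: "'a cmat \<Rightarrow> 'a cmat \<Rightarrow> 'a cmat" is "(**)" .
lift_definition norm_cmat :: "'a cmat \<Rightarrow> real" is "\<lambda>A. onorm ((*v) A)" .

definition sgn_cmat :: "'a cmat \<Rightarrow> 'a cmat" where "sgn_cmat A = A /\<^sub>R norm A"
definition dist_cmat :: "'a cmat \<Rightarrow> 'a cmat \<Rightarrow> real" where "dist_cmat A B = norm (A - B)"
definition uniformity_cmat :: "('a cmat \<times> 'a cmat) filter" where
  "uniformity_cmat = (INF e\<in>{0<..}. principal {(x, y). dist x y < e})"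
definition open_cmat :: "'a cmat set \<Rightarrow> bool" where
  "open_cmat U \<longleftrightarrow> (\<forall>x\<in>U. eventually (\<lambda>(x', y). x' = x \<longrightarrow> y \<in> U) uniformity)"

instance
proof
  fix A B C :: "'a cmat" and r s :: real
  show "A * B * C = A * (B * C)" by transfer (simp add: matrix_mul_assoc)
  show "(A + B) * C = A * C + B * C" by transfer (rule matrix_matrix_mult_add_rdistrib)
  show "A * (B + C) = A * B + A * C" by transfer (rule matrix_add_ldistrib)
  show "r *\<^sub>R A * B = r *\<^sub>R (A * B)" by transfer (rule scaleR_matrix_mult_left)
  show "A * r *\<^sub>R B = r *\<^sub>R (A * B)" by transfer (rule scaleR_matrix_mult_right)
  show "1 * A = A" "A * 1 = A" by (transfer, simp)+
  show "(0 :: 'a cmat) \<noteq> 1"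
    by transfer (auto simp: vec_eq_iff mat_def)
  show "norm A = 0 \<longleftrightarrow> A = 0" by transfer (rule onorm_matrix_eq_0)
  show "norm (A + B) \<le> norm A + norm B"
  proof transfer
    fix A B :: "complex^'a^'a"
    have "(*v) (A + B) = (\<lambda>v. A *v v + B *v v)"
      by (rule ext) (rule matrix_vector_mult_add_rdistrib)
    then show "onorm ((*v) (A + B)) \<le> onorm ((*v) A) + onorm ((*v) B)"
      by (simp add: onorm_triangle)
  qed
  show "norm (r *\<^sub>R A) = \<bar>r\<bar> * norm A"
  proof transfer
    fix A :: "complex^'a^'a" and r
    have "(*v) (r *\<^sub>R A) = (\<lambda>v. r *\<^sub>R (A *v v))"
      by (rule ext) (rule scaleR_matrix_vector_mult)
    then show "onorm ((*v) (r *\<^sub>R A)) = \<bar>r\<bar> * onorm ((*v) A)"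
      by (simp add: onorm_scaleR)
  qed
  show "norm (A * B) \<le> norm A * norm B"
  proof transfer
    fix A B :: "complex^'a^'a"
    show "onorm ((*v) (A ** B)) \<le> onorm ((*v) A) * onorm ((*v) B)"
      using onorm_compose [of "(*v) A" "(*v) B"] by (simp add: o_def matrix_vector_mul_assoc)
  qed
  have "(*v) (mat 1) = (\<lambda>v :: complex^'a. v)" by (rule ext) simp
  then show "norm (1 :: 'a cmat) = 1" by transfer (simp add: onorm_id)
  show "dist A B = norm (A - B)" by (rule dist_cmat_def)
  show "sgn A = A /\<^sub>R norm A" by (rule sgn_cmat_def)
  show "uniformity = (INF e\<in>{0<..}. principal {(x :: 'a cmat, y). dist x y < e})"
    by (rule uniformity_cmat_def)
  show "open U \<longleftrightarrow> (\<forall>x\<in>U. eventually (\<lambda>(x', y). x' = x \<longrightarrow> y \<in> U) uniformity)" for U :: "'a cmat set"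
    by (rule open_cmat_def)
qed

end

lemma bounded_linear_cmat: "bounded_linear cmat"
  unfolding linear_conv_bounded_linear [symmetric]
  by (rule linearI) (simp_all add: plus_cmat.abs_eq scaleR_cmat.abs_eq)

lemma norm_matrix_le_onorm:
  fixes A :: "complex^'n^'n"
  shows "norm A \<le> onorm ((*v) A) * real (CARD('n) * CARD('n))"
proof -
  have entry: "norm (A $ i $ j) \<le> onorm ((*v) A)" for i j
  proof -
    have "(A *v axis j 1) $ i = A $ i $ j"
      by (simp add: matrix_vector_mult_def axis_def if_distrib cong: if_cong)
    then have "norm (A $ i $ j) \<le> norm (A *v axis j 1)"
      using Finite_Cartesian_Product.norm_nth_le [of "A *v axis j 1" i] by simp
    also have "\<dots> \<le> onorm ((*v) A) * norm (axis j (1::complex))"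
      by (rule onorm) simp
    finally show ?thesis by simp
  qed
  have "norm A \<le> (\<Sum>i\<in>UNIV. norm (A $ i))"
    unfolding norm_vec_def [of A] by (rule L2_set_le_sum) simp
  also have "\<dots> \<le> (\<Sum>i\<in>UNIV. \<Sum>j\<in>UNIV. norm (A $ i $ j))"
    unfolding norm_vec_def [of "A $ _"] by (intro sum_mono L2_set_le_sum) simp
  also have "\<dots> \<le> (\<Sum>i\<in>(UNIV::'n set). \<Sum>j\<in>(UNIV::'n set). onorm ((*v) A))"
    by (intro sum_mono entry)
  finally show ?thesis by (simp add: mult_ac)
qed

lemma bounded_linear_matrix_of_cmat: "bounded_linear matrix_of_cmat"
proof (rule bounded_linear_intro)
  fix A B :: "'a cmat" and r :: real
  show "matrix_of_cmat (A + B) = matrix_of_cmat A + matrix_of_cmat B" by (rule plus_cmat.rep_eq)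
  show "matrix_of_cmat (r *\<^sub>R A) = r *\<^sub>R matrix_of_cmat A" by (rule scaleR_cmat.rep_eq)
  show "norm (matrix_of_cmat A) \<le> norm A * real (CARD('a) * CARD('a))"
    by transfer (rule norm_matrix_le_onorm)
qed

instance cmat :: (finite) banach
proof
  fix X :: "nat \<Rightarrow> 'a cmat" assume "Cauchy X"
  then have "Cauchy (\<lambda>n. matrix_of_cmat (X n))"
    by (rule bounded_linear.Cauchy [OF bounded_linear_matrix_of_cmat])
  then obtain L where "(\<lambda>n. matrix_of_cmat (X n)) \<longlonglongrightarrow> L"
    by (auto simp: Cauchy_convergent_iff convergent_def)
  from bounded_linear.tendsto [OF bounded_linear_cmat this]
  show "convergent X" by (auto simp: matrix_of_cmat_inverse convergent_def)
qed

instance cmat :: (finite) second_countable_topology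
proof
  obtain B :: "(complex^'a^'a) set set" where B: "countable B" "topological_basis B"
    using ex_countable_basis by blast
  have "topological_basis ((`) cmat ` B)"
  proof (rule topological_basisI)
    have vimage: "cmat ` S = matrix_of_cmat -` S" for S
      by (auto simp: cmat_inverse matrix_of_cmat_inverse image_iff) (metis matrix_of_cmat_inverse)
    show "open U" if "U \<in> (`) cmat ` B" for U
      using that topological_basis_open [OF B(2)] unfolding vimage
      by (auto intro!: open_vimage linear_continuous_on bounded_linear_matrix_of_cmat)
    fix U :: "'a cmat set" and x assume "open U" "x \<in> U"
    have "open (cmat -` U)"
      using \<open>open U\<close> by (auto intro!: open_vimage linear_continuous_on bounded_linear_cmat)
    moreover have "matrix_of_cmat x \<in> cmat -` U"
      using \<open>x \<in> U\<close> by (simp add: matrix_of_cmat_inverse)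
    ultimately obtain V where "V \<in> B" "matrix_of_cmat x \<in> V" "V \<subseteq> cmat -` U"
      using topological_basisE [OF B(2)] by metis
    then show "\<exists>B'\<in>(`) cmat ` B. x \<in> B' \<and> B' \<subseteq> U"
      by (intro bexI [of _ "cmat ` V"]) (auto simp: vimage, metis matrix_of_cmat_inverse subsetD vimageD)
  qed
  then show "\<exists>B::'a cmat set set. countable B \<and> open = generate_topology B"
    using B(1) by (intro exI [of _ "(`) cmat ` B"]) (simp add: topological_basis_imp_subbasis)
qed

section \<open>Positive Stable Matrices\<close>

definition decays :: "'a::{real_normed_algebra_1,banach} \<Rightarrow> 'a \<Rightarrow> bool" where
  "decays M X \<longleftrightarrow> (\<exists>K a. a > 0 \<and> (\<forall>s\<ge>0. norm (exp (- (s *\<^sub>R M)) * X) \<le> K * exp (- (a * s))))"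

lemma exp_stable_if_decays:
  assumes "decays M 1"
  shows "exp_stable M"
proof -
  obtain K a where "a > 0" and *: "\<And>s. s \<ge> 0 \<Longrightarrow> norm (exp (- (s *\<^sub>R M))) \<le> K * exp (- (a * s))"
    using assms by (auto simp: decays_def)
  have "norm (tpow t M) \<le> K * t powr a" if "t \<in> {0<..1}" for t
    using *[of "- ln t"] that by (simp add: tpow_def powr_def)
  with \<open>a > 0\<close> show ?thesis unfolding exp_stable_def by blast
qed

lemma decays_mult_left:
  assumes "decays M X" and "R * M = M * R"
  shows "decays M (R * X)"
proof -
  obtain K a where "a > 0" and *: "\<And>s. s \<ge> 0 \<Longrightarrow> norm (exp (- (s *\<^sub>R M)) * X) \<le> K * exp (- (a * s))"
    using assms(1) by (auto simp: decays_def)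
  have "norm (exp (- (s *\<^sub>R M)) * (R * X)) \<le> (norm R * K) * exp (- (a * s))" if "s \<ge> 0" for s
  proof -
    have "R * exp (- (s *\<^sub>R M)) = exp (- (s *\<^sub>R M)) * R"
      by (rule exp_commute) (simp add: assms(2))
    then have "exp (- (s *\<^sub>R M)) * (R * X) = R * (exp (- (s *\<^sub>R M)) * X)"
      by (simp flip: mult.assoc)
    then have "norm (exp (- (s *\<^sub>R M)) * (R * X)) \<le> norm R * norm (exp (- (s *\<^sub>R M)) * X)"
      by (simp add: norm_mult_ineq)
    also have "\<dots> \<le> norm R * (K * exp (- (a * s)))"
      using *[OF that] by (intro mult_left_mono) auto
    finally show ?thesis by (simp add: mult.assoc)
  qed
  with \<open>a > 0\<close> show ?thesis unfolding decays_def by blast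
qed

text \<open>Variation of constants: \<open>exp(s(L - M)) X\<close> has derivative \<open>exp(sL) exp(-sM) (L - M) X\<close>.\<close>

lemma decays_if_decays_diff_mult:
  assumes decays: "decays M ((M - L) * X)" and LM: "L * M = M * L" and "b > 0"
    and L: "\<And>s. s \<ge> 0 \<Longrightarrow> norm (exp (s *\<^sub>R L)) \<le> exp (b * s)"
      "\<And>s. s \<ge> 0 \<Longrightarrow> norm (exp (- (s *\<^sub>R L))) \<le> exp (- (b * s))"
  shows "decays M X"
proof -
  obtain K a0 where "a0 > 0"
    and K: "\<And>s. s \<ge> 0 \<Longrightarrow> norm (exp (- (s *\<^sub>R M)) * ((M - L) * X)) \<le> K * exp (- (a0 * s))"
    using decays by (auto simp: decays_def)
  have "K \<ge> 0" using order_trans [OF norm_ge_zero K [of 0]] by simp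
  define a where "a = min a0 (b / 2)"
  have a: "0 < a" "a \<le> a0" "a < b" using \<open>a0 > 0\<close> \<open>b > 0\<close> by (auto simp: a_def)
  define c where "c = K / (b - a)"
  have "c \<ge> 0" using \<open>K \<ge> 0\<close> a by (simp add: c_def)
  define y where "y s = exp (s *\<^sub>R (L - M)) * X" for s
  have exp_eq: "exp (s *\<^sub>R (L - M)) = exp (s *\<^sub>R L) * exp (- (s *\<^sub>R M))" for s
  proof -
    have "s *\<^sub>R (L - M) = s *\<^sub>R L + - (s *\<^sub>R M)" by (simp add: algebra_simps)
    moreover have "exp (s *\<^sub>R L + - (s *\<^sub>R M)) = exp (s *\<^sub>R L) * exp (- (s *\<^sub>R M))"
      by (rule exp_add_commuting) (simp add: LM)
    ultimately show ?thesis by simp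
  qed
  then have y_eq: "y s = exp (s *\<^sub>R L) * (exp (- (s *\<^sub>R M)) * X)" for s
    by (simp add: y_def mult.assoc)
  have y_deriv: "(y has_vector_derivative exp (s *\<^sub>R (L - M)) * (L - M) * X) (at s)" for s
    unfolding y_def
    by (rule has_vector_derivative_mult_left [OF exp_scaleR_has_vector_derivative_right])
  have y'_bound: "norm (exp (s *\<^sub>R (L - M)) * (L - M) * X) \<le> K * exp ((b - a) * s)" if "s \<ge> 0" for s
  proof -
    have "exp (s *\<^sub>R (L - M)) * (L - M) * X = - (exp (s *\<^sub>R L) * (exp (- (s *\<^sub>R M)) * ((M - L) * X)))"
      unfolding exp_eq by (simp add: algebra_simps)
    then have "norm (exp (s *\<^sub>R (L - M)) * (L - M) * X) \<le>
        norm (exp (s *\<^sub>R L)) * norm (exp (- (s *\<^sub>R M)) * ((M - L) * X))"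
      by (simp add: norm_mult_ineq)
    also have "\<dots> \<le> exp (b * s) * (K * exp (- (a * s)))"
    proof (rule mult_mono)
      have "K * exp (- (a0 * s)) \<le> K * exp (- (a * s))"
        using a that \<open>K \<ge> 0\<close> by (intro mult_left_mono) (auto intro: mult_right_mono)
      with K [OF that] show "norm (exp (- (s *\<^sub>R M)) * ((M - L) * X)) \<le> K * exp (- (a * s))"
        by (rule order_trans)
    qed (use L that in auto)
    also have "\<dots> = K * exp ((b - a) * s)"
      by (simp add: algebra_simps divide_inverse exp_diff exp_minus)
    finally show ?thesis .
  qed
  have y_bound: "norm (y s) \<le> norm X + c * exp ((b - a) * s)" if "s \<ge> 0" for s
  proof (cases "s = 0")
    case True
    then show ?thesis using \<open>c \<ge> 0\<close> by (simp add: y_def)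
  next
    case False
    have "norm (y s - y 0) \<le> c * exp ((b - a) * s) - c * exp ((b - a) * 0)"
    proof (rule differentiable_bound_general [where f = y and \<phi> = "\<lambda>s. c * exp ((b - a) * s)"
          and f' = "\<lambda>s. exp (s *\<^sub>R (L - M)) * (L - M) * X" and \<phi>' = "\<lambda>s. K * exp ((b - a) * s)"])
      show "0 < s" using that False by simp
      show "continuous_on {0..s} (\<lambda>s. c * exp ((b - a) * s))" by (intro continuous_intros)
      show "continuous_on {0..s} y"
        by (intro continuous_at_imp_continuous_on ballI) (rule has_vector_derivative_continuous [OF y_deriv])
      show "(y has_vector_derivative exp (x *\<^sub>R (L - M)) * (L - M) * X) (at x)" for x by (rule y_deriv)
      show "((\<lambda>s. c * exp ((b - a) * s)) has_vector_derivative K * exp ((b - a) * x)) (at x)" for x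
        unfolding has_real_derivative_iff_has_vector_derivative [symmetric] c_def using a
        by (auto intro!: derivative_eq_intros)
      show "norm (exp (x *\<^sub>R (L - M)) * (L - M) * X) \<le> K * exp ((b - a) * x)" if "0 < x" for x
        using y'_bound that by simp
    qed
    moreover have "norm (y s) \<le> norm (y s - y 0) + norm (y 0)"
      using norm_triangle_ineq [of "y s - y 0" "y 0"] by simp
    ultimately show ?thesis using \<open>c \<ge> 0\<close> by (simp add: y_def)
  qed
  have "norm (exp (- (s *\<^sub>R M)) * X) \<le> (norm X + c) * exp (- (a * s))" if "s \<ge> 0" for s
  proof -
    have "exp (- (s *\<^sub>R L)) * exp (s *\<^sub>R L) = 1"
      using exp_minus_inverse [of "- (s *\<^sub>R L)"] by simp
    then have "exp (- (s *\<^sub>R M)) * X = exp (- (s *\<^sub>R L)) * y s"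
      by (simp add: y_eq flip: mult.assoc)
    then have "norm (exp (- (s *\<^sub>R M)) * X) \<le> norm (exp (- (s *\<^sub>R L))) * norm (y s)"
      by (simp add: norm_mult_ineq)
    also have "\<dots> \<le> exp (- (b * s)) * (norm X + c * exp ((b - a) * s))"
      by (rule mult_mono) (use L y_bound that in auto)
    also have "\<dots> = norm X * exp (- (b * s)) + c * exp (- (a * s))"
      by (simp add: algebra_simps divide_inverse exp_diff exp_minus)
    also have "\<dots> \<le> norm X * exp (- (a * s)) + c * exp (- (a * s))"
      using a that by (intro add_right_mono mult_left_mono) (auto intro: mult_right_mono)
    finally show ?thesis by (simp add: algebra_simps)
  qed
  with a show ?thesis unfolding decays_def by blast
qed

definition scalar_cmat :: "complex \<Rightarrow> 'n::finite cmat" where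
  "scalar_cmat c = cmat (mat c)"

lemma mat_vector_mult: "mat c *v v = c *s v" for c :: complex
  by (simp add: vec_eq_iff matrix_vector_mult_def mat_def if_distrib [of "\<lambda>x. x * _"] cong: if_cong)

lemma mat_matrix_mult_commute: "mat c ** A = A ** mat c" for A :: "complex^'n^'n"
  by (simp add: vec_eq_iff matrix_matrix_mult_def mat_def mult.commute [of c]
      if_distrib [of "\<lambda>x. x * _"] if_distrib [of "\<lambda>x. _ * x"] cong: if_cong)

lemma mat_matrix_mult_mat: "mat c ** mat d = (mat (c * d) :: complex^'n^'n)"
  by (simp add: vec_eq_iff matrix_matrix_mult_def mat_def if_distrib [of "\<lambda>x. x * _"] cong: if_cong)

lemma scalar_cmat_commute: "scalar_cmat c * M = M * scalar_cmat c"
  unfolding scalar_cmat_def by transfer (rule mat_matrix_mult_commute)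

lemma scalar_cmat_mult: "scalar_cmat (c * d) = scalar_cmat c * scalar_cmat d"
  by (simp add: scalar_cmat_def times_cmat.abs_eq mat_matrix_mult_mat)

lemma scalar_cmat_add: "scalar_cmat (c + d) = scalar_cmat c + scalar_cmat d"
  by (simp add: scalar_cmat_def plus_cmat.abs_eq, simp add: cmat_inject vec_eq_iff mat_def)

lemma scalar_cmat_0 [simp]: "scalar_cmat 0 = 0"
  by (simp add: scalar_cmat_def zero_cmat_def cmat_inject vec_eq_iff mat_def)

lemma scalar_cmat_1 [simp]: "scalar_cmat 1 = 1"
  by (simp add: scalar_cmat_def one_cmat_def)

lemma scalar_cmat_scaleR: "scalar_cmat (r *\<^sub>R c) = r *\<^sub>R scalar_cmat c"
  by (simp add: scalar_cmat_def scaleR_cmat.abs_eq, simp add: cmat_inject vec_eq_iff mat_def)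

lemma scalar_cmat_of_real: "scalar_cmat (of_real r) = of_real r"
  using scalar_cmat_scaleR [of r 1] by (simp add: of_real_def)

lemma scalar_cmat_power: "scalar_cmat (c ^ n) = scalar_cmat c ^ n"
  by (induction n) (simp_all add: scalar_cmat_mult)

lemma bounded_linear_scalar_cmat: "bounded_linear scalar_cmat"
  unfolding linear_conv_bounded_linear [symmetric]
  by (rule linearI) (simp_all add: scalar_cmat_add scalar_cmat_scaleR)

lemma norm_scalar_cmat_le: "norm (scalar_cmat c) \<le> norm c"
  unfolding scalar_cmat_def
proof transfer
  fix c :: complex
  have "norm (c *s v) = norm c * norm v" for v :: "complex^'a"
    by (simp add: norm_vec_def norm_mult L2_set_right_distrib)
  then show "onorm ((*v) (mat c :: complex^'a^'a)) \<le> norm c"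
    by (intro onorm_bound) (simp_all add: mat_vector_mult)
qed

lemma exp_scalar_cmat: "exp (scalar_cmat c) = scalar_cmat (exp c)"
proof -
  have "scalar_cmat (exp c) = (\<Sum>n. scalar_cmat (c ^ n /\<^sub>R fact n))"
    unfolding exp_def by (rule bounded_linear.suminf [OF bounded_linear_scalar_cmat summable_exp_generic])
  then show ?thesis
    unfolding exp_def scalar_cmat_scaleR scalar_cmat_power by (rule sym)
qed

lemma norm_exp_scalar_cmat_le: "norm (exp (s *\<^sub>R scalar_cmat c)) \<le> exp (Re c * s)"
  using norm_scalar_cmat_le [of "exp (s *\<^sub>R c)"]
  by (simp add: exp_scalar_cmat mult.commute [of s] flip: scalar_cmat_scaleR)

definition poly_cmat :: "complex poly \<Rightarrow> 'n::finite cmat \<Rightarrow> 'n cmat" where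
  "poly_cmat p M = fold_coeffs (\<lambda>a X. scalar_cmat a + M * X) p 0"

lemma poly_cmat_0 [simp]: "poly_cmat 0 M = 0"
  by (simp add: poly_cmat_def)

lemma poly_cmat_pCons [simp]: "poly_cmat (pCons a p) M = scalar_cmat a + M * poly_cmat p M"
  by (cases "p = 0 \<and> a = 0") (auto simp: poly_cmat_def)

lemma poly_cmat_add: "poly_cmat (p + q) M = poly_cmat p M + poly_cmat q M"
  by (induction p q rule: poly_induct2) (simp_all add: scalar_cmat_add algebra_simps)

lemma poly_cmat_smult: "poly_cmat (smult c p) M = scalar_cmat c * poly_cmat p M"
proof (induction p)
  case (pCons a p)
  have "scalar_cmat c * (M * poly_cmat p M) = M * (scalar_cmat c * poly_cmat p M)"
    by (metis mult.assoc scalar_cmat_commute)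
  with pCons show ?case
    by (simp add: scalar_cmat_mult scalar_cmat_commute [of a "scalar_cmat c"] algebra_simps)
qed simp

lemma poly_cmat_sum: "poly_cmat (sum f A) M = (\<Sum>i\<in>A. poly_cmat (f i) M)"
  by (induction A rule: infinite_finite_induct) (simp_all add: poly_cmat_add)

lemma poly_cmat_monom: "poly_cmat (monom c i) M = scalar_cmat c * M ^ i"
proof (induction i)
  case (Suc i)
  have "M * (scalar_cmat c * M ^ i) = scalar_cmat c * (M * M ^ i)"
    by (metis mult.assoc scalar_cmat_commute)
  with Suc show ?case by (simp add: monom_Suc)
qed (simp add: monom_0)

lemma poly_cmat_commute: "M * poly_cmat p M = poly_cmat p M * M"
proof (induction p)
  case (pCons a p)
  have "M * (M * poly_cmat p M) = M * poly_cmat p M * M"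
    by (simp add: mult.assoc pCons(2) [symmetric])
  then show ?case by (simp add: distrib_left distrib_right scalar_cmat_commute)
qed simp

lemma poly_cmat_linear_factor:
  "poly_cmat ([:- z, 1:] * q) M = poly_cmat q M * (M - scalar_cmat z)"
proof -
  have minus: "scalar_cmat (- z) = - scalar_cmat z"
    using scalar_cmat_scaleR [of "-1" z] by simp
  have "[:- z, 1:] * q = smult (- z) q + pCons 0 q" by simp
  then have "poly_cmat ([:- z, 1:] * q) M = scalar_cmat (- z) * poly_cmat q M + M * poly_cmat q M"
    by (simp only: poly_cmat_add poly_cmat_smult poly_cmat_pCons scalar_cmat_0 add_0)
  then show ?thesis
    by (simp add: minus poly_cmat_commute scalar_cmat_commute [of z "poly_cmat q M"] algebra_simps)
qed

lemma ex_annihilating_poly: "\<exists>p. p \<noteq> 0 \<and> poly_cmat p M = 0"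
proof -
  let ?f = "\<lambda>i. matrix_of_cmat (M ^ i)"
  define d where "d = DIM(complex^'a^'a)"
  have "\<exists>c. (\<exists>i\<le>d. c i \<noteq> 0) \<and> (\<Sum>i\<le>d. c i *\<^sub>R ?f i) = 0"
  proof (cases "inj_on ?f {..d}")
    case True
    then have "card (?f ` {..d}) = Suc d" by (simp add: card_image)
    then have "dependent (?f ` {..d})"
      by (intro dependent_biggerset) (simp add: d_def)
    then obtain u where u: "(\<exists>v\<in>?f ` {..d}. u v \<noteq> 0)" "(\<Sum>v\<in>?f ` {..d}. u v *\<^sub>R v) = 0"
      by (auto simp: dependent_finite)
    then have "(\<Sum>i\<le>d. u (?f i) *\<^sub>R ?f i) = 0" by (simp add: sum.reindex [OF True])
    with u(1) show ?thesis by (intro exI [of _ "\<lambda>i. u (?f i)"]) auto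
  next
    case False
    then obtain i j where ij: "i \<le> d" "j \<le> d" "i \<noteq> j" "?f i = ?f j" by (auto simp: inj_on_def)
    have "(\<Sum>k\<le>d. ((if k = i then 1 else 0) - (if k = j then 1 else 0)) *\<^sub>R ?f k) = ?f i - ?f j"
    proof -
      have "(\<Sum>k\<le>d. ((if k = i then 1 else 0) - (if k = j then 1 else 0)) *\<^sub>R ?f k) =
          (\<Sum>k\<le>d. (if k = i then ?f k else 0) - (if k = j then ?f k else 0))"
        by (intro sum.cong) auto
      then show ?thesis using ij(1,2) by (simp add: sum_subtractf)
    qed
    with ij show ?thesis
      by (intro exI [of _ "\<lambda>k. (if k = i then 1 else 0) - (if k = j then 1 else 0)"]) auto
  qed
  then obtain c where c: "\<exists>i\<le>d. c i \<noteq> 0" "(\<Sum>i\<le>d. c i *\<^sub>R ?f i) = 0" by blast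
  define p where "p = (\<Sum>i\<le>d. monom (complex_of_real (c i)) i)"
  have "coeff p i = of_real (c i)" if "i \<le> d" for i
    using that by (simp add: p_def coeff_sum if_distrib cong: if_cong)
  with c(1) have "p \<noteq> 0" by auto
  moreover have "poly_cmat p M = (\<Sum>i\<le>d. c i *\<^sub>R M ^ i)"
    by (simp add: p_def poly_cmat_sum poly_cmat_monom scalar_cmat_of_real scaleR_conv_of_real)
  moreover have "matrix_of_cmat (\<Sum>i\<le>d. c i *\<^sub>R M ^ i) = 0"
    using c(2) by (simp add: bounded_linear.linear [OF bounded_linear_matrix_of_cmat] linear_sum scaleR_cmat.rep_eq)
  ultimately show ?thesis
    by (intro exI [of _ p]) (simp add: zero_cmat.rep_eq flip: matrix_of_cmat_inject)
qed

lemma scalar_diff_invertible: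
  assumes "\<not> eigenvalue M l"
  shows "\<exists>R. R * (cmat M - scalar_cmat l) = 1 \<and> R * cmat M = cmat M * R"
proof -
  have "inj ((*v) (M - mat l))"
  proof (rule injI)
    fix x y assume "(M - mat l) *v x = (M - mat l) *v y"
    then have "M *v (x - y) = l *s (x - y)"
      by (simp add: algebra_simps mat_vector_mult)
    with assms have "x - y = 0" unfolding eigenvalue_def by blast
    then show "x = y" by simp
  qed
  then obtain B where B: "B ** (M - mat l) = mat 1"
    using matrix_left_invertible_injective by blast
  then have "(M - mat l) ** B = mat 1"
    using matrix_left_right_inverse by blast
  with B have R: "cmat B * (cmat M - scalar_cmat l) = 1" "(cmat M - scalar_cmat l) * cmat B = 1"
    by (simp_all add: scalar_cmat_def one_cmat_def times_cmat.abs_eq minus_cmat.abs_eq)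
  then have "cmat B * cmat M = cmat M * cmat B"
    by (simp add: algebra_simps scalar_cmat_commute)
  with R show ?thesis by blast
qed

theorem exp_stable_if_positive_stable:
  assumes "positive_stable M"
  shows "exp_stable (cmat M)"
proof (rule exp_stable_if_decays)
  have *: "decays (cmat M) X" if "p \<noteq> 0" "poly_cmat p (cmat M) * X = 0" for p X
    using that
  proof (induction "degree p" arbitrary: p X)
    case 0
    then obtain c where p: "p = [:c:]" "c \<noteq> 0" by (metis degree_eq_zeroE pCons_0_0)
    with 0 have "scalar_cmat c * X = 0" by simp
    then have "scalar_cmat (inverse c * c) * X = 0" by (simp add: scalar_cmat_mult mult.assoc)
    with p have "X = 0" by simp
    then show ?case unfolding decays_def by (intro exI [of _ 0] exI [of _ 1]) simp
  next
    case (Suc n)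
    have "\<not> constant (poly p)" using Suc by (simp add: constant_degree)
    then obtain l where "poly p l = 0" using fundamental_theorem_of_algebra by blast
    then obtain q where p: "p = [:- l, 1:] * q" by (auto simp: poly_eq_0_iff_dvd)
    have "q \<noteq> 0" using p Suc by auto
    moreover have "n = degree q" using Suc(2) \<open>q \<noteq> 0\<close> unfolding p by (subst (asm) degree_mult_eq) auto
    moreover have "poly_cmat q (cmat M) * ((cmat M - scalar_cmat l) * X) = 0"
      using Suc.prems unfolding p poly_cmat_linear_factor by (simp add: mult.assoc)
    ultimately have dec: "decays (cmat M) ((cmat M - scalar_cmat l) * X)" by (intro Suc.hyps(1)) auto
    show ?case
    proof (cases "eigenvalue M l")
      case True
      with assms have "Re l > 0" by (simp add: positive_stable_def)
      with dec show ?thesis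
      proof (rule decays_if_decays_diff_mult [OF _ scalar_cmat_commute])
        fix s :: real
        show "norm (exp (s *\<^sub>R scalar_cmat l :: 'a cmat)) \<le> exp (Re l * s)"
          by (rule norm_exp_scalar_cmat_le)
        show "norm (exp (- (s *\<^sub>R scalar_cmat l) :: 'a cmat)) \<le> exp (- (Re l * s))"
          using norm_exp_scalar_cmat_le [of "- s" l] by simp
      qed
    next
      case False
      then obtain R where R: "R * (cmat M - scalar_cmat l) = 1" "R * cmat M = cmat M * R"
        using scalar_diff_invertible by blast
      then show ?thesis using decays_mult_left [OF dec, of R] by (simp flip: mult.assoc)
    qed
  qed
  show "decays (cmat M) 1"
    using ex_annihilating_poly [of "cmat M"] * [of _ 1] by auto
qed

section \<open>Matrix Functions in the Banach Algebra\<close>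

lemma matrix_of_cmat_cmat [simp]: "matrix_of_cmat (cmat A) = A"
  by (simp add: cmat_inverse)

lemma cmat_hom:
  shows cmat_mult: "cmat (A ** B) = cmat A * cmat B"
    and cmat_add: "cmat (A + B) = cmat A + cmat B"
    and cmat_diff: "cmat (A - B) = cmat A - cmat B"
    and cmat_scaleR: "cmat (r *\<^sub>R A) = r *\<^sub>R cmat A"
    and cmat_mat_1: "cmat (mat 1) = 1"
  by (simp_all add: times_cmat.abs_eq plus_cmat.abs_eq minus_cmat.abs_eq scaleR_cmat.abs_eq one_cmat_def)

lemma cmat_mat_of_nat: "cmat (mat (of_nat n)) = of_nat n"
  using scalar_cmat_of_real [of "real n"] by (simp add: scalar_cmat_def)

lemma cmat_mat_of_real_mult: "cmat (mat (of_real r) ** A) = r *\<^sub>R cmat A"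
  by (simp add: cmat_mult scaleR_conv_of_real scalar_cmat_of_real flip: scalar_cmat_def)

lemma cmat_mat_pow: "cmat (mat_pow A n) = cmat A ^ n"
  by (induction n) (simp_all add: cmat_hom power_commutes)

lemma cmat_mat_pochhammer: "cmat (mat_pochhammer A n) = pochhammer_alg (cmat A) n"
  by (induction n) (simp_all add: cmat_hom cmat_mat_of_nat)

lemma matrix_sums_iff: "f sums A \<longleftrightarrow> (\<lambda>n. cmat (f n)) sums cmat A"
  using bounded_linear.sums [OF bounded_linear_cmat, of f A]
    bounded_linear.sums [OF bounded_linear_matrix_of_cmat, of "\<lambda>n. cmat (f n)" "cmat A"]
  by auto

lemma matrix_sums_unique: "(\<lambda>n. cmat (f n)) sums X \<Longrightarrow> cmat (\<Sum>n. f n) = X"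
  using matrix_sums_iff [of f "matrix_of_cmat X"] by (auto simp: matrix_of_cmat_inverse sums_iff)

lemma cmat_mat_exp: "cmat (mat_exp A) = exp (cmat A)"
  unfolding mat_exp_def
proof (rule matrix_sums_unique)
  show "(\<lambda>n. cmat ((1 / fact n) *\<^sub>R mat_pow A n)) sums exp (cmat A)"
    using summable_sums [OF summable_exp_generic, of "cmat A"]
    by (simp add: cmat_scaleR cmat_mat_pow exp_def divide_inverse)
qed

lemma cmat_mat_powr: "cmat (mat_powr t A) = tpow t (cmat A)"
  by (simp add: mat_powr_def tpow_def cmat_mat_exp cmat_scaleR)

lemma cmat_rGamma_mat: "cmat (rGamma_mat A) = rGamma_shift 0 (cmat A)"
  unfolding rGamma_mat_def
proof (rule matrix_sums_unique)
  have "(deriv ^^ n) rGamma 0 / fact n = complex_of_real (rGamma_coeff 0 n)" for n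
    by (simp add: of_real_rGamma_coeff)
  then show "(\<lambda>n. cmat (mat ((deriv ^^ n) rGamma 0 / fact n) ** mat_pow A n)) sums rGamma_shift 0 (cmat A)"
    using rGamma_shift_sums [of 0 "cmat A"] by (simp add: cmat_mat_of_real_mult cmat_mat_pow)
qed

lemma
  fixes f :: "real \<Rightarrow> 'n::finite cmat"
  assumes f: "set_integrable lborel S f" and g: "\<And>t. t \<in> S \<Longrightarrow> cmat (g t) = f t"
  shows absolutely_integrable_on_cmat: "g absolutely_integrable_on S"
    and integral_cmat: "cmat (integral S g) = (LINT t:S|lborel. f t)"
proof -
  have eq: "indicator S t *\<^sub>R g t = matrix_of_cmat (indicator S t *\<^sub>R f t)" for t
    by (cases "t \<in> S") (simp_all add: zero_cmat.rep_eq flip: g)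
  have int: "set_integrable lborel S g"
    using integrable_bounded_linear [OF bounded_linear_matrix_of_cmat f [unfolded set_integrable_def]]
    by (simp add: set_integrable_def eq)
  then show "g absolutely_integrable_on S"
    unfolding set_integrable_def by (subst integrable_completion) (auto dest: borel_measurable_integrable)
  have "integral S g = (LINT t:S|lborel. g t)"
    using set_borel_integral_eq_integral(2) [OF int] by simp
  also have "\<dots> = matrix_of_cmat (LINT t:S|lborel. f t)"
    unfolding set_lebesgue_integral_def eq
    by (rule integral_bounded_linear [OF bounded_linear_matrix_of_cmat f [unfolded set_integrable_def]])
  finally show "cmat (integral S g) = (LINT t:S|lborel. f t)"
    by (simp add: matrix_of_cmat_inverse)
qed

lemma cmat_Gamma_mat:
  assumes "positive_stable A"
  shows "cmat (Gamma_mat A) = Gamma_alg (cmat A)"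
  unfolding Gamma_mat_def Gamma_alg_def
  by (rule integral_cmat [OF set_integrable_Gamma_integrand [OF exp_stable_if_positive_stable [OF assms]]])
    (simp add: Gamma_integrand_def cmat_hom cmat_mat_powr)

section \<open>The Terms of the Series\<close>

lemma invertible_mat_pochhammer:
  assumes "\<And>k. invertible (A + mat (of_nat k))"
  shows "invertible (mat_pochhammer A n)"
proof (induction n)
  case 0
  show ?case by (auto simp: invertible_def intro: exI [of _ "mat 1"])
next
  case (Suc n)
  then show ?case by (simp add: invertible_mult assms)
qed

lemma matrix_inv_inverse:
  fixes P :: "complex^'n^'n"
  assumes "invertible P"
  shows "P ** matrix_inv P = mat 1" and "matrix_inv P ** P = mat 1"
  using someI_ex [OF assms [unfolded invertible_def]] unfolding matrix_inv_def by auto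

lemma matrix_inv_commute:
  fixes P X :: "complex^'n^'n"
  assumes "invertible P" and "X ** P = P ** X"
  shows "X ** matrix_inv P = matrix_inv P ** X"
proof -
  have "matrix_inv P ** X = matrix_inv P ** (X ** P) ** matrix_inv P"
    using matrix_inv_inverse(1) [OF assms(1)] by (simp flip: matrix_mul_assoc)
  also have "\<dots> = (matrix_inv P ** P) ** X ** matrix_inv P"
    by (simp only: assms(2) matrix_mul_assoc)
  finally show ?thesis by (simp add: matrix_inv_inverse(2) [OF assms(1)])
qed

lemma mat_prod_commute:
  assumes "\<And>j. 1 \<le> j \<Longrightarrow> j \<le> k \<Longrightarrow> X ** F j = F j ** X"
  shows "X ** mat_prod F k = mat_prod F k ** X"
  using assms
proof (induction k)
  case (Suc k)
  have FS: "X ** F (Suc k) = F (Suc k) ** X"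
    by (rule Suc.prems) simp_all
  have IH: "X ** mat_prod F k = mat_prod F k ** X"
    by (rule Suc.IH) (simp add: Suc.prems)
  have "X ** mat_prod F k ** F (Suc k) = mat_prod F k ** (X ** F (Suc k))"
    by (simp only: IH matrix_mul_assoc)
  also have "\<dots> = mat_prod F k ** F (Suc k) ** X"
    by (subst FS) (simp only: matrix_mul_assoc)
  finally show ?case by (simp add: matrix_mul_assoc)
qed simp

lemma mat_pochhammer_commute:
  assumes "X ** M = M ** X"
  shows "X ** mat_pochhammer M n = mat_pochhammer M n ** X"
proof -
  have "cmat X * cmat M = cmat M * cmat X"
    using assms by (simp flip: cmat_mult)
  from pochhammer_alg_commute [OF this, of n]
  have "cmat (X ** mat_pochhammer M n) = cmat (mat_pochhammer M n ** X)"
    by (simp add: cmat_mult cmat_mat_pochhammer)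
  then show ?thesis by (simp add: cmat_inject)
qed

lemma pRq_term_Suc:
  assumes inv: "\<And>j k. 1 \<le> j \<Longrightarrow> j \<le> q \<Longrightarrow> invertible (D j + mat (of_nat k))"
    and comm: "\<And>j. 1 \<le> j \<Longrightarrow> j \<le> q \<Longrightarrow> C (Suc p) ** D j = D j ** C (Suc p)"
  shows "pRq_term (Suc p) (Suc q) C D A B z n =
    pRq_term p q C D A B z n ** mat_pochhammer (C (Suc p)) n ** matrix_inv (mat_pochhammer (D (Suc q)) n)"
proof -
  let ?Y = "mat_pochhammer (C (Suc p)) n" and ?Z = "mat_prod (\<lambda>j. matrix_inv (mat_pochhammer (D j) n)) q"
  have "?Y ** ?Z = ?Z ** ?Y"
  proof (rule mat_prod_commute)
    fix j assume j: "1 \<le> j" "j \<le> q"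
    have "D j ** ?Y = ?Y ** D j"
      by (rule mat_pochhammer_commute) (rule comm [OF j, symmetric])
    then have "?Y ** mat_pochhammer (D j) n = mat_pochhammer (D j) n ** ?Y"
      by (intro mat_pochhammer_commute) simp
    then show "?Y ** matrix_inv (mat_pochhammer (D j) n) = matrix_inv (mat_pochhammer (D j) n) ** ?Y"
      by (intro matrix_inv_commute invertible_mat_pochhammer inv j)
  qed
  then have swap: "X ** ?Y ** ?Z = X ** ?Z ** ?Y" for X
    by (simp flip: matrix_mul_assoc)
  show ?thesis
    by (simp add: pRq_term_def matrix_mul_assoc swap)
qed

lemma pRq_term_mult: "pRq_term p q C D A B (c * z) n = mat (c ^ n) ** pRq_term p q C D A B z n"
proof -
  have "mat ((c * z) ^ n / fact n) = mat (c ^ n) ** (mat (z ^ n / fact n) :: complex^'a^'a)"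
    by (simp add: mat_matrix_mult_mat power_mult_distrib)
  then show ?thesis by (simp add: pRq_term_def matrix_mul_assoc)
qed

lemma cmat_pRq_term_of_real_mult:
  "cmat (pRq_term p q C D A B (of_real t * z) n) = t ^ n *\<^sub>R cmat (pRq_term p q C D A B z n)"
  unfolding pRq_term_mult using cmat_mat_of_real_mult [of "t ^ n"] by simp

lemma pRq_term_geometric_bound:
  assumes "norm z < norm w" and "summable (pRq_term p q C D A B w)"
  shows "\<exists>\<rho>>1. \<exists>K. \<forall>n. norm (cmat (pRq_term p q C D A B z n)) * \<rho> ^ n \<le> K"
proof -
  have "w \<noteq> 0" using assms(1) by auto
  have "summable (\<lambda>n. cmat (pRq_term p q C D A B w n))"
    by (rule bounded_linear.summable [OF bounded_linear_cmat assms(2)])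
  then obtain K where K: "norm (cmat (pRq_term p q C D A B w n)) \<le> K" for n
    using summable_imp_Bseq BseqE by metis
  obtain \<rho> where \<rho>: "\<rho> > 1" "norm (z / w) * \<rho> \<le> 1"
  proof (cases "z = 0")
    case True
    then show thesis using that [of 2] by simp
  next
    case False
    then show thesis using that [of "norm w / norm z"] assms(1) \<open>w \<noteq> 0\<close> by (simp add: norm_divide)
  qed
  have "norm (cmat (pRq_term p q C D A B z n)) * \<rho> ^ n \<le> K" for n
  proof -
    have "cmat (pRq_term p q C D A B z n) = scalar_cmat ((z / w) ^ n) * cmat (pRq_term p q C D A B w n)"
      using pRq_term_mult [of p q C D A B "z / w" w n] \<open>w \<noteq> 0\<close> by (simp add: cmat_mult scalar_cmat_def)
    then have "norm (cmat (pRq_term p q C D A B z n)) \<le>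
        norm (scalar_cmat ((z / w) ^ n) :: 'a cmat) * norm (cmat (pRq_term p q C D A B w n))"
      by (simp add: norm_mult_ineq)
    also have "\<dots> \<le> norm (z / w) ^ n * K"
    proof (rule mult_mono)
      show "norm (scalar_cmat ((z / w) ^ n) :: 'a cmat) \<le> norm (z / w) ^ n"
        using norm_scalar_cmat_le [of "(z / w) ^ n"] by (simp add: norm_power)
    qed (use K in auto)
    finally have "norm (cmat (pRq_term p q C D A B z n)) * \<rho> ^ n \<le> norm (z / w) ^ n * K * \<rho> ^ n"
      using \<rho> by (intro mult_right_mono) auto
    also have "\<dots> = (norm (z / w) * \<rho>) ^ n * K" by (simp add: power_mult_distrib)
    also have "\<dots> \<le> 1 * K"
      using \<rho> order_trans [OF norm_ge_zero K [of n]] by (intro mult_right_mono power_le_one) auto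
    finally show ?thesis by simp
  qed
  with \<rho>(1) show ?thesis by blast
qed

theorem theorem5p1:
  fixes p q :: nat
    and A B :: "complex^'r^'r"
    and C D :: "nat \<Rightarrow> complex^'r^'r"
    and z :: complex
  assumes "p \<ge> 1" and "q \<ge> 1"
    and D_invertible: "\<And>j k. 1 \<le> j \<Longrightarrow> j \<le> q \<Longrightarrow> invertible (D j + mat (of_nat k))"
    and "positive_stable (C p)"
    and "positive_stable (D q)"
    and "positive_stable (D q - C p)"
    and commute: "\<And>j. 1 \<le> j \<Longrightarrow> j \<le> q \<Longrightarrow> C p ** D j = D j ** C p"
    and "norm z < 1"
    and converges: "\<exists>w. norm z < norm w \<and> summable (pRq_term p q C D A B w)"
  shows "summable (pRq_term p q C D A B z) \<and>
    (\<forall>t\<in>{0<..<1}. summable (pRq_term (p - 1) (q - 1) C D A B (of_real t * z))) \<and>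
    (\<lambda>t. pRq (p - 1) (q - 1) C D A B (of_real t * z)
        ** mat_powr t (C p - mat 1) ** mat_powr (1 - t) (D q - C p - mat 1))
      absolutely_integrable_on {0<..<1} \<and>
    pRq p q C D A B z =
      integral {0<..<1} (\<lambda>t. pRq (p - 1) (q - 1) C D A B (of_real t * z)
          ** mat_powr t (C p - mat 1) ** mat_powr (1 - t) (D q - C p - mat 1))
        ** Gamma_mat (D q) ** rGamma_mat (C p) ** rGamma_mat (D q - C p)"
proof -
  obtain p' q' where p: "p = Suc p'" and q: "q = Suc q'"
    using assms(1,2) by (metis One_nat_def Suc_le_D)
  define T where "T n = cmat (pRq_term p q C D A B z n)" for n
  define S where "S n = cmat (pRq_term p' q' C D A B z n)" for n
  define Q where "Q n = cmat (matrix_inv (mat_pochhammer (D q) n))" for n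
  let ?C = "cmat (C p)" and ?D = "cmat (D q)"
  have C: "exp_stable ?C" and D: "exp_stable ?D" and DC: "exp_stable (?D - ?C)"
    using exp_stable_if_positive_stable assms(4-6) by (auto simp flip: cmat_diff)
  have comm: "?C * ?D = ?D * ?C"
    using commute [of q] assms(2) by (simp flip: cmat_mult)
  have "invertible (mat_pochhammer (D q) n)" for n
    using assms(2) by (intro invertible_mat_pochhammer D_invertible) auto
  then have Q: "pochhammer_alg ?D n * Q n = 1" "Q n * pochhammer_alg ?D n = 1" for n
    unfolding Q_def by (simp_all add: matrix_inv_inverse cmat_mat_1 flip: cmat_mat_pochhammer cmat_mult)
  have T: "T n = S n * pochhammer_alg ?C n * Q n" for n
    unfolding T_def S_def Q_def p q
    by (subst pRq_term_Suc) (use D_invertible commute in \<open>auto simp: p q cmat_mult cmat_mat_pochhammer\<close>)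
  obtain \<rho> K where "\<rho> > 1" and "\<And>n. norm (T n) * \<rho> ^ n \<le> K"
    using converges pRq_term_geometric_bound unfolding T_def by metis
  then have S: "summable (\<lambda>n. norm (S n))"
    by (rule summable_norm_pochhammer_quotient [OF C comm]) (simp add: T Q mult.assoc)
  have S_sums: "(\<lambda>n. t ^ n *\<^sub>R S n) sums cmat (pRq p' q' C D A B (of_real t * z))"
    and S_summable: "summable (pRq_term p' q' C D A B (of_real t * z))" if "t \<in> {0<..<1}" for t
  proof -
    have "summable (\<lambda>n. t ^ n *\<^sub>R S n)"
    proof (rule summable_comparison_test' [OF S])
      show "norm (t ^ n *\<^sub>R S n) \<le> norm (S n)" for n
        using that by (simp add: power_le_one mult_left_le_one_le)
    qed
    then have "(\<lambda>n. cmat (pRq_term p' q' C D A B (of_real t * z) n)) sums (\<Sum>n. t ^ n *\<^sub>R S n)"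
      by (simp add: cmat_pRq_term_of_real_mult S_def summable_sums)
    then have *: "pRq_term p' q' C D A B (of_real t * z) sums matrix_of_cmat (\<Sum>n. t ^ n *\<^sub>R S n)"
      by (simp add: matrix_sums_iff matrix_of_cmat_inverse)
    then show "summable (pRq_term p' q' C D A B (of_real t * z))" by (rule sums_summable)
    then have "pRq_term p' q' C D A B (of_real t * z) sums pRq p' q' C D A B (of_real t * z)"
      unfolding pRq_def by (rule summable_sums)
    then show "(\<lambda>n. t ^ n *\<^sub>R S n) sums cmat (pRq p' q' C D A B (of_real t * z))"
      by (simp add: matrix_sums_iff cmat_pRq_term_of_real_mult S_def)
  qed
  let ?f = "\<lambda>t. (\<Sum>n. t ^ n *\<^sub>R S n) * Beta_integrand ?C (?D - ?C) t"
  let ?g = "\<lambda>t. pRq p' q' C D A B (of_real t * z) ** mat_powr t (C p - mat 1) ** mat_powr (1 - t) (D q - C p - mat 1)"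
  have f: "set_integrable lborel {0<..<1} ?f"
    by (rule set_integrable_series_Beta [OF C D DC comm S Q(1)])
  have g: "cmat (?g t) = ?f t" if "t \<in> {0<..<1}" for t
    using S_sums [OF that]
    by (simp add: sums_iff cmat_hom cmat_mat_powr Beta_integrand_def mult.assoc)
  let ?R = "integral {0<..<1} ?g ** Gamma_mat (D q) ** rGamma_mat (C p) ** rGamma_mat (D q - C p)"
  have int: "cmat (integral {0<..<1} ?g) = (LINT t:{0<..<1}|lborel. ?f t)"
    by (rule integral_cmat [OF f g])
  have "(\<lambda>n. S n * pochhammer_alg ?C n * Q n) sums
      ((LINT t:{0<..<1}|lborel. ?f t) * Gamma_alg ?D * rGamma_shift 0 ?C * rGamma_shift 0 (?D - ?C))"
    by (rule sums_integral_series_Beta [OF C D DC comm S Q(1)])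
  then have "T sums cmat ?R"
    unfolding int [symmetric] T [symmetric]
    by (simp add: cmat_mult cmat_diff cmat_rGamma_mat cmat_Gamma_mat assms(5))
  then have "pRq_term p q C D A B z sums ?R"
    by (simp add: matrix_sums_iff flip: T_def)
  moreover have "?g absolutely_integrable_on {0<..<1}"
    by (rule absolutely_integrable_on_cmat [OF f g])
  ultimately show ?thesis
    using S_summable by (simp add: p q pRq_def sums_iff)
qed

end
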